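(* No acknowledgment-based memoryless Contention Resolution protocol $\mathcal D$ in the LocalClock model satisfies both $$L^{\exp}_{\mathcal D}(n)=o\!\left(\frac{n\log^2 n}{(\log\log n)^2}\right)\quad\text{and}\quad L^{\mathrm{whp}}_{\mathcal D}(n)=n\log^{O(1)}n .$$
   Context: Contention Resolution. Time is divided into slots indexed by $\mathbb N$. There are $n$ identical parties; $n$ is unknown to the protocol, so one fixed protocol is used for all $n$. An adversary wakes up the $n$ parties; $t_u$ is the wake-up time of party $u$. An acknowledgment-based LocalClock protocol is a distribution $\mathcal D$ over infinite binary sequences: each party $u$ independently draws $X^{(u)}=(X^{(u)}_1,X^{(u)}_2,\dots)\sim\mathcal D$ and attempts to grab the shared resource in slot $t_u+i$ (local time $i\ge1$) iff $X^{(u)}_i=1$ and $u$ has not succeeded in an earlier slot. A party succeeds in a slot iff it is the only party attempting to grab in that slot. Parties receive no other feedback. The protocol is memoryless if the bits $X^{(u)}_1,X^{(u)}_2,\dots$ are mutually independent, so that $\mathcal D$ is determined by $p(i)=\Pr[X^{(u)}_i=1]$. The adversary is oblivious: it fixes all wake-up times in advance, and wakes up $n$ parties. The latency of $u$ is $L^{(u)}_{\mathcal D,\mathcal A[n]}=t_u^{\mathrm{succ}}-t_u$, where $t_u^{\mathrm{succ}}$ is the slot in which $u$ succeeds ($\infty$ if never). $L^{\exp}_{\mathcal D}(n)=\sup_{\mathcal A[n]}\max_{u}\mathbb E[L^{(u)}_{\mathcal D,\mathcal A[n]}]$; $L_{\mathcal D}(n,q)$ is the least $L\in\mathbb N\cup\{\infty\}$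 such that $\Pr[L^{(u)}_{\mathcal D,\mathcal A[n]}\le L]\ge 1-q$ for all $\mathcal A[n]$ and all $u$; and $L^{\mathrm{whp}}_{\mathcal D}(n)=L_{\mathcal D}(n,n^{-2})$. *)

theory Defs
  imports "HOL-Probability.Probability" "HOL-Library.Landau_Symbols"
begin

text \<open>An acknowledgment-based LocalClock protocol is a probability distribution on binary
  sequences; the index set \<open>{1..}\<close> reflects that local time starts at 1.\<close>

definition ack_protocol :: "(nat \<Rightarrow> bool) measure \<Rightarrow> bool" where
  "ack_protocol D \<longleftrightarrow>
     prob_space D \<and> sets D = sets (PiM {1..} (\<lambda>_::nat. count_space (UNIV :: bool set)))"

definition memoryless :: "(nat \<Rightarrow> bool) measure \<Rightarrow> bool" where
  "memoryless D \<longleftrightarrow>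
     prob_space.indep_vars D (\<lambda>_. count_space UNIV) (\<lambda>i X. X i) {1..}"

text \<open>The parties are \<open>{..<n}\<close>, \<open>t u\<close> is the wake-up slot of party \<open>u\<close>, and \<open>x u\<close> is the
  binary sequence it has drawn. The set \<open>succeeded n t x s\<close> consists of the parties that
  succeed in some slot strictly before \<open>s\<close>, and \<open>attempting n t x s\<close> of those that attempt
  to grab the resource in slot \<open>s\<close>.\<close>

definition attempting_given ::
  "nat \<Rightarrow> (nat \<Rightarrow> nat) \<Rightarrow> (nat \<Rightarrow> nat \<Rightarrow> bool) \<Rightarrow> nat set \<Rightarrow> nat \<Rightarrow> nat set" where
  "attempting_given n t x S s = {u. u < n \<and> t u < s \<and> x u (s - t u) \<and> u \<notin> S}"

primrec succeeded :: "nat \<Rightarrow> (nat \<Rightarrow> nat) \<Rightarrow> (nat \<Rightarrow> nat \<Rightarrow> bool) \<Rightarrow> nat \<Rightarrow> nat set" where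
  "succeeded n t x 0 = {}"
| "succeeded n t x (Suc s) =
     succeeded n t x s \<union> {u. attempting_given n t x (succeeded n t x s) s = {u}}"

definition attempting :: "nat \<Rightarrow> (nat \<Rightarrow> nat) \<Rightarrow> (nat \<Rightarrow> nat \<Rightarrow> bool) \<Rightarrow> nat \<Rightarrow> nat set" where
  "attempting n t x s = attempting_given n t x (succeeded n t x s) s"

text \<open>The infimum of the empty set is \<open>\<infinity>\<close>, and \<open>\<infinity> - enat k = \<infinity>\<close>.\<close>

definition success_slot :: "nat \<Rightarrow> (nat \<Rightarrow> nat) \<Rightarrow> (nat \<Rightarrow> nat \<Rightarrow> bool) \<Rightarrow> nat \<Rightarrow> enat" where
  "success_slot n t x u = Inf {enat s | s. attempting n t x s = {u}}"

definition latency :: "nat \<Rightarrow> (nat \<Rightarrow> nat) \<Rightarrow> (nat \<Rightarrow> nat \<Rightarrow> bool) \<Rightarrow> nat \<Rightarrow> enat" where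
  "latency n t x u = success_slot n t x u - enat (t u)"

text \<open>The \<open>n\<close> parties draw their sequences independently from \<open>D\<close>.\<close>

definition draws :: "(nat \<Rightarrow> bool) measure \<Rightarrow> nat \<Rightarrow> (nat \<Rightarrow> nat \<Rightarrow> bool) measure" where
  "draws D n = PiM {..<n} (\<lambda>_. D)"

text \<open>An oblivious adversary is a function \<open>t\<close> of wake-up slots, of which only the values on
  \<open>{..<n}\<close> matter. The value at \<open>n = 0\<close> is irrelevant.\<close>

definition L_exp :: "(nat \<Rightarrow> bool) measure \<Rightarrow> nat \<Rightarrow> ennreal" where
  "L_exp D n =
     (SUP t. MAX u\<in>{..<n}. \<integral>\<^sup>+ x. ennreal_of_enat (latency n t x u) \<partial>draws D n)"

definition L_quant :: "(nat \<Rightarrow> bool) measure \<Rightarrow> nat \<Rightarrow> real \<Rightarrow> enat" where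
  "L_quant D n q =
     (LEAST L. \<forall>t. \<forall>u<n.
        measure (draws D n) {x \<in> space (draws D n). latency n t x u \<le> L} \<ge> 1 - q)"

definition L_whp :: "(nat \<Rightarrow> bool) measure \<Rightarrow> nat \<Rightarrow> enat" where
  "L_whp D n = L_quant D n (1 / real n ^ 2)"

text \<open>Asymptotic bounds for functions that may take the value \<open>\<infinity>\<close>: such a function has to be
  eventually finite.\<close>

definition L_exp_smallo :: "(nat \<Rightarrow> bool) measure \<Rightarrow> (nat \<Rightarrow> real) \<Rightarrow> bool" where
  "L_exp_smallo D g \<longleftrightarrow>
     (\<forall>\<^sub>F n in sequentially. L_exp D n \<noteq> \<infinity>) \<and> (\<lambda>n. enn2real (L_exp D n)) \<in> o(g)"

definition L_whp_bigo :: "(nat \<Rightarrow> bool) measure \<Rightarrow> (nat \<Rightarrow> real) \<Rightarrow> bool" where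
  "L_whp_bigo D g \<longleftrightarrow>
     (\<forall>\<^sub>F n in sequentially. L_whp D n \<noteq> \<infinity>) \<and> (\<lambda>n. real (the_enat (L_whp D n))) \<in> O(g)"

end

theory Submission
  imports Defs "HOL-Real_Asymp.Real_Asymp"
begin

text \<open>Let \<open>p i\<close> be the probability of an attempt at local time \<open>i\<close>, and \<open>j0\<close> the first time with
  \<open>p j0 > 0\<close>. A slot can be jammed at the cost of \<open>O(log n)\<close> parties by waking them up \<open>j0\<close> slots
  earlier: it is the first slot in which they can attempt, so none of them has succeeded before.
  Jamming the first \<open>n / (log n)^2\<close> slots, and all later ones in which \<open>p\<close> is not small, shows that a
  bound \<open>n log^k n\<close> with high probability forces the small values of \<open>p\<close> to have mass of order
  \<open>log n\<close> on each of the intervals from \<open>n / (log n)^2\<close> to \<open>n log^k n\<close>. Summing over the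
  \<open>log n / log log n\<close> many such scales gives mass \<open>S\<close> of order \<open>(log n)^2 / log log n\<close>.

  Waking up one party in every \<open>S / \<beta>\<close> slots then keeps the contention of order \<open>\<beta>\<close>. Successes thin
  out the parties, but with \<open>\<beta>\<close> a large multiple of \<open>log log n\<close> each party succeeds with only
  polylogarithmically small probability; since the contention is a sum of many small terms, an
  exponential supermartingale shows that it stays large in all slots. So with probability at
  least 1/2 a fixed party does not succeed for about \<open>n S / \<beta>\<close> slots. The same argument with \<open>\<beta>\<close> of
  order \<open>log n\<close> shows beforehand that the total mass of \<open>p\<close> is polylogarithmic.\<close>

section \<open>Success before a slot as a Markov chain\<close>

locale memoryless_protocol =
  fixes D :: "(nat \<Rightarrow> bool) measure"
  assumes ack: "ack_protocol D" and memoryless: "memoryless D"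
begin

sublocale D: prob_space D
  using ack by (simp add: ack_protocol_def)

definition p :: "nat \<Rightarrow> real" where
  "p i = measure D {X \<in> space D. X i}"

definition bit_prob :: "nat \<Rightarrow> bool \<Rightarrow> real" where
  "bit_prob i b = (if b then p i else 1 - p i)"

lemma p_nonneg: "0 \<le> p i" and p_le_1: "p i \<le> 1"
  by (simp_all add: p_def)

lemma bit_measurable:
  assumes "1 \<le> i"
  shows "(\<lambda>X. X i) \<in> measurable D (count_space UNIV)"
  using memoryless assms by (auto simp: memoryless_def D.indep_vars_def)

lemma bit_event: 
  assumes "1 \<le> i"
  shows "{X \<in> space D. X i = b} \<in> sets D"
  using bit_measurable[OF assms] by measurable

lemma bit_prob_measure:
  assumes "1 \<le> i"
  shows "measure D {X \<in> space D. X i = b} = bit_prob i b"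
proof (cases b)
  case False
  have "{X \<in> space D. X i = b} = space D - {X \<in> space D. X i}"
    using False by auto
  then show ?thesis
    using False bit_event[OF assms, of True] by (simp add: D.prob_compl bit_prob_def p_def)
qed (simp add: bit_prob_def p_def)

lemma cylinder_party:
  assumes "finite J" "J \<subseteq> {1..}"
  shows "measure D {X \<in> space D. \<forall>i\<in>J. X i = b i} = (\<Prod>i\<in>J. bit_prob i (b i))"
    and "{X \<in> space D. \<forall>i\<in>J. X i = b i} \<in> sets D"
proof -
  have *: "{X \<in> space D. \<forall>i\<in>J. X i = b i} = (\<Inter>i\<in>J. (\<lambda>X. X i) -` {b i} \<inter> space D)"
    if "J \<noteq> {}"
    using that by auto
  show "measure D {X \<in> space D. \<forall>i\<in>J. X i = b i} = (\<Prod>i\<in>J. bit_prob i (b i))"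
  proof (cases "J = {}")
    case False
    have "measure D (\<Inter>i\<in>J. (\<lambda>X. X i) -` {b i} \<inter> space D)
        = (\<Prod>i\<in>J. measure D ((\<lambda>X. X i) -` {b i} \<inter> space D))"
      by (rule D.indep_varsD[OF memoryless[unfolded memoryless_def] False assms]) auto
    also have "\<dots> = (\<Prod>i\<in>J. bit_prob i (b i))"
    proof (rule prod.cong)
      fix i assume "i \<in> J"
      then have "1 \<le> i" using assms by auto
      have "(\<lambda>X. X i) -` {b i} \<inter> space D = {X \<in> space D. X i = b i}" by auto
      then show "measure D ((\<lambda>X. X i) -` {b i} \<inter> space D) = bit_prob i (b i)"
        using bit_prob_measure[OF \<open>1 \<le> i\<close>] by simp
    qed simp
    finally show ?thesis using *[OF False] by simp
  qed (simp add: D.prob_space)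
  show "{X \<in> space D. \<forall>i\<in>J. X i = b i} \<in> sets D"
    using assms by (intro sets.sets_Collect_finite_All bit_event) auto
qed

section \<open>The joint law of all drawn bits: cylinder events and measurability\<close>

abbreviation pr :: "nat \<Rightarrow> ((nat \<Rightarrow> nat \<Rightarrow> bool) \<Rightarrow> bool) \<Rightarrow> real" where
  "pr n E \<equiv> measure (draws D n) {x \<in> space (draws D n). E x}"

lemma prob_space_draws: "prob_space (draws D n)"
  unfolding draws_def by (intro prob_space_PiM D.prob_space_axioms)

text \<open>A cylinder event: \<open>Q\<close> lists the fixed coordinates (party, local time). The
  pattern \<open>b\<close> is total, so that cylinders on disjoint coordinates merge into one by a
  case distinction.\<close>

definition agrees :: "(nat \<times> nat) set \<Rightarrow> (nat \<times> nat \<Rightarrow> bool) \<Rightarrow> (nat \<Rightarrow> nat \<Rightarrow> bool) \<Rightarrow> bool" where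
  "agrees Q b x \<longleftrightarrow> (\<forall>(v, i)\<in>Q. x v i = b (v, i))"

text \<open>Slicing \<open>Q\<close> by party, the product measure factors over the parties, and
  memorylessness factors each slice over the local times.\<close>

lemma cylinder:
  assumes "finite Q" "Q \<subseteq> {..<n} \<times> {1..}"
  shows "pr n (agrees Q b) = (\<Prod>(v, i)\<in>Q. bit_prob i (b (v, i)))"
proof -
  interpret P: finite_product_prob_space "\<lambda>_::nat. D" "{..<n}"
    by unfold_locales auto
  have Q: "Q = (SIGMA v:{..<n}. Q `` {v})" using assms(2) by auto
  have fin: "finite (Q `` {v})" for v
    by (rule finite_subset[of _ "snd ` Q"]) (use assms(1) in force)+
  have sub: "Q `` {v} \<subseteq> {1..}" for v using assms(2) by auto
  have "{x \<in> space (draws D n). agrees Q b x}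
      = (\<Pi>\<^sub>E v\<in>{..<n}. {X \<in> space D. \<forall>i\<in>Q `` {v}. X i = b (v, i)})"
    unfolding draws_def space_PiM agrees_def using assms(2) 
    by (auto simp: PiE_iff Ball_def extensional_def split: prod.splits)
  then have "pr n (agrees Q b)
      = (\<Prod>v<n. measure D {X \<in> space D. \<forall>i\<in>Q `` {v}. X i = b (v, i)})"
    unfolding draws_def
    using P.prob_times[of "\<lambda>v. {X \<in> space D. \<forall>i\<in>Q `` {v}. X i = b (v, i)}"] 
      cylinder_party(2)[OF fin sub] by simp
  also have "\<dots> = (\<Prod>v<n. \<Prod>i\<in>Q `` {v}. bit_prob i (b (v, i)))"
    by (intro prod.cong refl cylinder_party(1)[OF fin sub])
  also have "\<dots> = (\<Prod>(v, i)\<in>Q. bit_prob i (b (v, i)))"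
    by (subst prod.Sigma) (use fin Q in auto)
  finally show ?thesis .
qed

lemma pred_bit [measurable]:
  assumes "v < n" "1 \<le> i"
  shows "Measurable.pred (draws D n) (\<lambda>x. x v i)"
proof -
  have "(\<lambda>x. x v) \<in> measurable (draws D n) D"
    unfolding draws_def using assms(1) by (intro measurable_component_singleton) auto
  from measurable_compose[OF this bit_measurable[OF assms(2)]] show ?thesis by simp
qed

lemma pred_agrees [measurable]:
  assumes "finite Q" "Q \<subseteq> {..<n} \<times> {1..}"
  shows "Measurable.pred (draws D n) (agrees Q b)"
proof -
  have "Measurable.pred (draws D n) (\<lambda>x. \<forall>q\<in>Q. x (fst q) (snd q) = b q)"
  proof (rule pred_intros_finite(3)[OF assms(1)])
    fix q assume "q \<in> Q"
    then have "Measurable.pred (draws D n) (\<lambda>x. x (fst q) (snd q))"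
      using assms(2) by (intro pred_bit) auto
    then show "Measurable.pred (draws D n) (\<lambda>x. x (fst q) (snd q) = b q)" by measurable
  qed
  then show ?thesis by (simp add: agrees_def[abs_def] split_beta)
qed

lemma succeeded_subset: "succeeded n t x s \<subseteq> {..<n}"
proof (induction s)
  case (Suc s)
  then show ?case by (auto simp: attempting_given_def)
qed simp

lemma pred_succeeded: "Measurable.pred (draws D n) (\<lambda>x. v \<in> succeeded n t x s)"
proof (induction s arbitrary: v)
  case (Suc s)
  note [measurable] = Suc
  have att: "Measurable.pred (draws D n) (\<lambda>x. w \<in> attempting_given n t x (succeeded n t x s) s)" for w
  proof (cases "w < n \<and> t w < s")
    case True
    then have [measurable]: "Measurable.pred (draws D n) (\<lambda>x. x w (s - t w))"
      by (intro pred_bit) auto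
    show ?thesis using True unfolding attempting_given_def by simp
  qed (auto simp: attempting_given_def)
  have eq: "attempting_given n t x S s = {v} \<longleftrightarrow> (v < n \<and> (\<forall>w\<in>{..<n}. w \<in> attempting_given n t x S s \<longleftrightarrow> w = v))" for x S
    by (auto simp: attempting_given_def)
  have "Measurable.pred (draws D n) (\<lambda>x. v \<in> succeeded n t x s \<or> (v < n \<and> (\<forall>w\<in>{..<n}. w \<in> attempting_given n t x (succeeded n t x s) s \<longleftrightarrow> w = v)))"
    using att by measurable
  then show ?case by (simp add: eq[symmetric])
qed simp

lemma pred_succeeded_eq [measurable]:
  "Measurable.pred (draws D n) (\<lambda>x. succeeded n t x s = S)"
proof (cases "S \<subseteq> {..<n}")
  case True
  have "succeeded n t x s = S \<longleftrightarrow> (\<forall>w\<in>{..<n}. w \<in> succeeded n t x s \<longleftrightarrow> w \<in> S)" for x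
    using succeeded_subset[of n t x s] True by auto
  moreover have "Measurable.pred (draws D n) (\<lambda>x. \<forall>w\<in>{..<n}. w \<in> succeeded n t x s \<longleftrightarrow> w \<in> S)"
    using pred_succeeded by measurable
  ultimately show ?thesis by simp
next
  case False
  then have "(\<lambda>x. succeeded n t x s = S) = (\<lambda>x. False)"
    using succeeded_subset by (metis)
  then show ?thesis by simp
qed

end

text \<open>For independent events with probabilities \<open>r v\<close>, the sum is the probability
  that exactly one of them occurs.\<close>

lemma sum_single_success_le_1:
  fixes r :: "'a \<Rightarrow> real"
  assumes "finite A" "\<And>v. v \<in> A \<Longrightarrow> 0 \<le> r v \<and> r v \<le> 1"
  shows "(\<Sum>v\<in>A. r v * (\<Prod>w\<in>A - {v}. 1 - r w)) \<le> 1"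
proof -
  \<comment> \<open>The induction needs the probability that no event occurs on the left as
    well.\<close>
  have "(\<Sum>v\<in>A. r v * (\<Prod>w\<in>A - {v}. 1 - r w)) + (\<Prod>w\<in>A. 1 - r w) \<le> 1"
    using assms
  proof (induction A rule: finite_induct)
    case (insert a A)
    let ?P = "\<Prod>w\<in>A. 1 - r w" and ?S = "\<Sum>v\<in>A. r v * (\<Prod>w\<in>A - {v}. 1 - r w)"
    have P: "0 \<le> ?P" using insert by (intro prod_nonneg) auto
    have "(\<Sum>v\<in>A. r v * (\<Prod>w\<in>insert a A - {v}. 1 - r w)) = (1 - r a) * ?S"
      unfolding sum_distrib_left
    proof (rule sum.cong)
      fix v assume "v \<in> A"
      then have "insert a A - {v} = insert a (A - {v})" using insert by auto
      then show "r v * (\<Prod>w\<in>insert a A - {v}. 1 - r w) = (1 - r a) * (r v * (\<Prod>w\<in>A - {v}. 1 - r w))"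
        using insert by simp
    qed simp
    then have "(\<Sum>v\<in>insert a A. r v * (\<Prod>w\<in>insert a A - {v}. 1 - r w)) + (\<Prod>w\<in>insert a A. 1 - r w)
        = r a * ?P + (1 - r a) * ?S + (1 - r a) * ?P"
      using insert by simp
    also have "\<dots> = ?P + (1 - r a) * ?S" by (simp add: algebra_simps)
    also have "\<dots> \<le> ?P + 1 * ?S"
      using insert.prems insert.hyps
      by (intro add_left_mono mult_right_mono sum_nonneg mult_nonneg_nonneg prod_nonneg) auto
    also have "\<dots> \<le> 1" using insert by simp
    finally show ?case .
  qed simp
  moreover have "0 \<le> (\<Prod>w\<in>A. 1 - r w)" using assms by (intro prod_nonneg) auto
  ultimately show ?thesis by linarith
qed

context memoryless_protocol
begin

section \<open>Transitions of the set of successful parties\<close>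

definition attempt_prob :: "(nat \<Rightarrow> nat) \<Rightarrow> nat \<Rightarrow> nat \<Rightarrow> real" where
  "attempt_prob t s v = (if t v < s then p (s - t v) else 0)"

text \<open>For \<open>v\<close> outside \<open>S\<close>, the conditional probability that
  \<open>v\<close> succeeds in slot \<open>s\<close> when \<open>S\<close> is the set of earlier
  successes. Since \<open>attempt_prob\<close> ignores success, \<open>S\<close> is excluded from
  the product.\<close>

definition success_prob :: "nat \<Rightarrow> (nat \<Rightarrow> nat) \<Rightarrow> nat \<Rightarrow> nat set \<Rightarrow> nat \<Rightarrow> real" where
  "success_prob n t s S v =
     attempt_prob t s v * (\<Prod>w\<in>{..<n} - S - {v}. 1 - attempt_prob t s w)"

lemma attempt_prob_bounds: "0 \<le> attempt_prob t s v" "attempt_prob t s v \<le> 1"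
  using p_nonneg p_le_1 by (simp_all add: attempt_prob_def)

lemma success_prob_nonneg: "0 \<le> success_prob n t s S v"
  unfolding success_prob_def using attempt_prob_bounds
  by (intro mult_nonneg_nonneg prod_nonneg) auto

lemma sum_success_prob_le_1: "(\<Sum>v\<in>{..<n} - S. success_prob n t s S v) \<le> 1"
  unfolding success_prob_def
  by (rule sum_single_success_le_1) (use attempt_prob_bounds in auto)

definition slot_coords :: "nat \<Rightarrow> (nat \<Rightarrow> nat) \<Rightarrow> nat \<Rightarrow> nat set \<Rightarrow> (nat \<times> nat) set" where
  "slot_coords n t s S = (\<lambda>w. (w, s - t w)) ` {w \<in> {..<n} - S. t w < s}"

lemma attempting_singleton_iff:
  assumes "v \<in> {..<n} - S" "t v < s"
  shows "attempting_given n t x S s = {v} \<longleftrightarrow> agrees (slot_coords n t s S) (\<lambda>(w, i). w = v) x"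
  unfolding attempting_given_def slot_coords_def agrees_def using assms by auto

lemma prod_slot_coords:
  assumes "v \<in> {..<n} - S" "t v < s"
  shows "(\<Prod>(w, i)\<in>slot_coords n t s S. bit_prob i (w = v)) = success_prob n t s S v"
proof -
  let ?W = "{w \<in> {..<n} - S. t w < s}"
  have "(\<Prod>(w, i)\<in>slot_coords n t s S. bit_prob i (w = v)) = (\<Prod>w\<in>?W. bit_prob (s - t w) (w = v))"
    unfolding slot_coords_def by (subst prod.reindex) (auto simp: inj_on_def)
  also have "\<dots> = bit_prob (s - t v) True * (\<Prod>w\<in>?W - {v}. bit_prob (s - t w) (w = v))"
    using assms by (subst prod.remove[of _ v]) auto
  also have "(\<Prod>w\<in>?W - {v}. bit_prob (s - t w) (w = v)) = (\<Prod>w\<in>{..<n} - S - {v}. 1 - attempt_prob t s w)"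
    by (rule prod.mono_neutral_cong_left) (auto simp: bit_prob_def attempt_prob_def)
  finally show ?thesis using assms by (simp add: success_prob_def attempt_prob_def bit_prob_def)
qed

text \<open>The bits belonging to slot \<open>s\<close> or later; the value of
  \<open>succeeded\<close> at \<open>s\<close> is determined by the bits of strictly earlier
  slots.\<close>

definition future_coords :: "nat \<Rightarrow> (nat \<Rightarrow> nat) \<Rightarrow> nat \<Rightarrow> (nat \<times> nat) set" where
  "future_coords n t s = {(v, i). v < n \<and> 1 \<le> i \<and> s \<le> t v + i}"

lemma agrees_union:
  assumes "Q \<inter> R = {}"
  shows "agrees Q b x \<and> agrees R c x \<longleftrightarrow> agrees (Q \<union> R) (\<lambda>q. if q \<in> Q then b q else c q) x"
  using assms unfolding agrees_def by (auto split: if_splits)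

text \<open>Both claims are proved by a simultaneous induction on \<open>s\<close>: the transition from slot \<open>s\<close>
  consults only bits that the first claim makes independent of the past.\<close>

lemma past_independent_of_future:
  assumes "finite Q" "Q \<subseteq> future_coords n t s"
  shows "pr n (\<lambda>x. succeeded n t x s = S \<and> agrees Q b x)
       = pr n (\<lambda>x. succeeded n t x s = S) * (\<Prod>(v, i)\<in>Q. bit_prob i (b (v, i)))"
    and "pr n (\<lambda>x. succeeded n t x (Suc s) = S)
       = pr n (\<lambda>x. succeeded n t x s = S)
         - (\<Sum>v\<in>{..<n} - S. pr n (\<lambda>x. succeeded n t x s = S) * success_prob n t s S v)
         + (\<Sum>v\<in>{..<n} \<inter> S. pr n (\<lambda>x. succeeded n t x s = S - {v}) * success_prob n t s (S - {v}) v)"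
proof -
  interpret P: prob_space "draws D n" by (rule prob_space_draws)
  let ?\<mu> = "\<lambda>s S. pr n (\<lambda>x. succeeded n t x s = S)"
  let ?R = "\<lambda>s S. ?\<mu> s S - (\<Sum>v\<in>{..<n} - S. ?\<mu> s S * success_prob n t s S v)
         + (\<Sum>v\<in>{..<n} \<inter> S. ?\<mu> s (S - {v}) * success_prob n t s (S - {v}) v)"
  have one: "pr n (\<lambda>x. succeeded n t x s = S \<and> attempting_given n t x S s = {v} \<and> agrees Q b x)
      = ?\<mu> s S * success_prob n t s S v * (\<Prod>(v, i)\<in>Q. bit_prob i (b (v, i)))"
    if IH: "\<And>S Q b. \<lbrakk>finite Q; Q \<subseteq> future_coords n t s\<rbrakk> \<Longrightarrow>
          pr n (\<lambda>x. succeeded n t x s = S \<and> agrees Q b x) = ?\<mu> s S * (\<Prod>(v, i)\<in>Q. bit_prob i (b (v, i)))"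
      and Q: "finite Q" "Q \<subseteq> future_coords n t (Suc s)" and v: "v \<in> {..<n} - S" for s S v Q b
  proof (cases "t v < s")
    case False
    then have "attempting_given n t x S s \<noteq> {v}" for x by (auto simp: attempting_given_def)
    with False show ?thesis by (simp add: success_prob_def attempt_prob_def)
  next
    case True
    let ?C = "slot_coords n t s S"
    let ?c = "\<lambda>q. if q \<in> ?C then (\<lambda>(w, i). w = v) q else b q"
    have disj: "?C \<inter> Q = {}" and C: "finite ?C" "?C \<union> Q \<subseteq> future_coords n t s"
      using Q(2) by (auto simp: slot_coords_def future_coords_def)
    have "pr n (\<lambda>x. succeeded n t x s = S \<and> attempting_given n t x S s = {v} \<and> agrees Q b x)
        = pr n (\<lambda>x. succeeded n t x s = S \<and> agrees (?C \<union> Q) ?c x)"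
      unfolding attempting_singleton_iff[of v n S t s, OF v True] agrees_union[OF disj] ..
    also have "\<dots> = ?\<mu> s S * (\<Prod>(w, i)\<in>?C \<union> Q. bit_prob i (?c (w, i)))"
      using C Q by (intro IH) auto
    also have "(\<Prod>(w, i)\<in>?C \<union> Q. bit_prob i (?c (w, i)))
        = (\<Prod>(w, i)\<in>?C. bit_prob i (?c (w, i))) * (\<Prod>(w, i)\<in>Q. bit_prob i (?c (w, i)))"
      using C Q disj by (intro prod.union_disjoint) auto
    also have "(\<Prod>(w, i)\<in>?C. bit_prob i (?c (w, i))) = success_prob n t s S v"
      unfolding prod_slot_coords[of v n S t s, OF v True, symmetric] by (intro prod.cong) auto
    also have "(\<Prod>(w, i)\<in>Q. bit_prob i (?c (w, i))) = (\<Prod>(v, i)\<in>Q. bit_prob i (b (v, i)))"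
      using disj by (intro prod.cong) auto
    finally show ?thesis by simp
  qed
  have step: "pr n (\<lambda>x. succeeded n t x (Suc s) = S \<and> agrees Q b x)
      = ?R s S * (\<Prod>(v, i)\<in>Q. bit_prob i (b (v, i)))"
    if IH: "\<And>S Q b. \<lbrakk>finite Q; Q \<subseteq> future_coords n t s\<rbrakk> \<Longrightarrow>
          pr n (\<lambda>x. succeeded n t x s = S \<and> agrees Q b x) = ?\<mu> s S * (\<Prod>(v, i)\<in>Q. bit_prob i (b (v, i)))"
      and Q: "finite Q" "Q \<subseteq> future_coords n t (Suc s)" for s S Q b
  proof -
    have Q': "Q \<subseteq> future_coords n t s" "Q \<subseteq> {..<n} \<times> {1..}" using Q(2) by (auto simp: future_coords_def)
    note [measurable] = pred_agrees[OF Q(1) Q'(2)]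
    have att: "Measurable.pred (draws D n) (\<lambda>x. attempting_given n t x S s = {v})" if "v \<in> {..<n} - S" for v S
    proof (cases "t v < s")
      case True
      have "finite (slot_coords n t s S)" "slot_coords n t s S \<subseteq> {..<n} \<times> {1..}" by (auto simp: slot_coords_def)
      from pred_agrees[OF this] show ?thesis using attempting_singleton_iff[of v n S t s, OF that True] by simp
    next
      case False
      then have "attempting_given n t x S s \<noteq> {v}" for x by (auto simp: attempting_given_def)
      then show ?thesis by simp
    qed
    let ?E = "\<lambda>S v x. succeeded n t x s = S \<and> attempting_given n t x S s = {v} \<and> agrees Q b x"
    let ?set = "\<lambda>P. {x \<in> space (draws D n). P x}"
    have meas: "?set (?E S v) \<in> sets (draws D n)" if "v \<in> {..<n} - S" for v S
      using att[OF that] by measurable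
    let ?A = "?set (\<lambda>x. succeeded n t x s = S \<and> agrees Q b x)"
    let ?B = "\<Union>v\<in>{..<n} - S. ?set (?E S v)" 
    let ?C = "\<Union>v\<in>{..<n} \<inter> S. ?set (?E (S - {v}) v)"
    have attD: "v \<in> {..<n} - S" if "attempting_given n t x S s = {v}" for x S v
      using that by (auto simp: attempting_given_def)
    \<comment> \<open>At most one party joins per slot: either the state was already
      \<open>S\<close> and nobody succeeds (\<open>?A - ?B\<close>), or it was
      \<open>S - {v}\<close> and \<open>v\<close> succeeds (\<open>?C\<close>).\<close>
    have "?set (\<lambda>x. succeeded n t x (Suc s) = S \<and> agrees Q b x) = (?A - ?B) \<union> ?C"
    proof (intro set_eqI)
      fix x
      show "x \<in> ?set (\<lambda>x. succeeded n t x (Suc s) = S \<and> agrees Q b x) \<longleftrightarrow> x \<in> (?A - ?B) \<union> ?C"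
      proof (cases "\<exists>v. attempting_given n t x (succeeded n t x s) s = {v}")
        case True
        then obtain v where v: "attempting_given n t x (succeeded n t x s) s = {v}" ..
        have v': "v \<in> {..<n} - succeeded n t x s" using attD[OF v] .
        have "succeeded n t x (Suc s) = insert v (succeeded n t x s)" using v by auto
        then show ?thesis using v v' by auto
      next
        case False
        then have "succeeded n t x (Suc s) = succeeded n t x s" by auto
        then show ?thesis using False by auto
      qed
    qed
    moreover have "?C \<inter> (?A - ?B) = {}" by auto
    moreover have "?B \<subseteq> ?A" by auto
    moreover have "?A \<in> sets (draws D n)" by measurable
    moreover have "?B \<in> sets (draws D n)" by (intro sets.finite_UN meas) auto
    moreover have "?C \<in> sets (draws D n)" by (intro sets.finite_UN meas) auto
    ultimately have "pr n (\<lambda>x. succeeded n t x (Suc s) = S \<and> agrees Q b x)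
        = measure (draws D n) ?A - measure (draws D n) ?B + measure (draws D n) ?C"
      by (simp add: P.finite_measure_Union P.finite_measure_Diff Int_commute)
    also have "measure (draws D n) ?B = (\<Sum>v\<in>{..<n} - S. pr n (?E S v))"
      using meas by (intro P.finite_measure_finite_Union) (auto simp: disjoint_family_on_def)
    also have "measure (draws D n) ?C = (\<Sum>v\<in>{..<n} \<inter> S. pr n (?E (S - {v}) v))"
      using meas by (intro P.finite_measure_finite_Union) (auto simp: disjoint_family_on_def)
    also have "(\<Sum>v\<in>{..<n} - S. pr n (?E S v)) = (\<Sum>v\<in>{..<n} - S. ?\<mu> s S * success_prob n t s S v * (\<Prod>(v, i)\<in>Q. bit_prob i (b (v, i))))"
      by (intro sum.cong refl one IH Q) auto
    also have "(\<Sum>v\<in>{..<n} \<inter> S. pr n (?E (S - {v}) v)) = (\<Sum>v\<in>{..<n} \<inter> S. ?\<mu> s (S - {v}) * success_prob n t s (S - {v}) v * (\<Prod>(v, i)\<in>Q. bit_prob i (b (v, i))))"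
      by (intro sum.cong refl one IH Q) auto
    also have "measure (draws D n) ?A = ?\<mu> s S * (\<Prod>(v, i)\<in>Q. bit_prob i (b (v, i)))"
      by (rule IH[OF Q(1) Q'(1)])
    finally show ?thesis
      unfolding sum_distrib_right[symmetric] left_diff_distrib distrib_right .
  qed
  \<comment> \<open>In slot 0 every coordinate lies in the future and the claim is the cylinder
    formula. Afterwards, \<open>step\<close> for empty \<open>Q\<close> identifies
    \<open>?R s S\<close> as the probability of the new state.\<close>
  have gen: "pr n (\<lambda>x. succeeded n t x s = S \<and> agrees Q b x) = ?\<mu> s S * (\<Prod>(v, i)\<in>Q. bit_prob i (b (v, i)))"
    if "finite Q" "Q \<subseteq> future_coords n t s" for s S Q b
    using that
  proof (induction s arbitrary: S Q b)
    case 0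
    then have "Q \<subseteq> {..<n} \<times> {1..}" by (auto simp: future_coords_def)
    from cylinder[OF 0(1) this] show ?case by (cases "S = {}") (auto simp: P.prob_space)
  next
    case (Suc s)
    have "?\<mu> (Suc s) S = ?R s S"
      using step[OF Suc.IH finite.emptyI empty_subsetI] by (simp add: agrees_def)
    with step[OF Suc.IH Suc.prems] show ?case by simp
  qed
  show "pr n (\<lambda>x. succeeded n t x s = S \<and> agrees Q b x)
       = ?\<mu> s S * (\<Prod>(v, i)\<in>Q. bit_prob i (b (v, i)))" by (rule gen[OF assms])
  show "?\<mu> (Suc s) S = ?R s S"
    using step[OF gen finite.emptyI empty_subsetI] by (simp add: agrees_def)
qed

text \<open>The inflow into \<open>S\<close> from \<open>S - {v}\<close> is credited to the
  predecessor, which turns the transition equation into the drift of \<open>F\<close> along the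
  chain.\<close>

lemma expectation_step:
  fixes F :: "nat set \<Rightarrow> real"
  defines "\<mu> \<equiv> \<lambda>n t s S. pr n (\<lambda>x. succeeded n t x s = S)"
  shows "(\<Sum>S\<in>Pow {..<n}. \<mu> n t (Suc s) S * F S)
       = (\<Sum>S\<in>Pow {..<n}. \<mu> n t s S *
            (F S + (\<Sum>v\<in>{..<n} - S. success_prob n t s S v * (F (insert v S) - F S))))"
proof -
  let ?m = "\<mu> n t s" and ?\<alpha> = "success_prob n t s" and ?V = "{..<n}"
  have swap: "(\<Sum>S\<in>Pow ?V. \<Sum>v\<in>?V \<inter> S. ?m (S - {v}) * ?\<alpha> (S - {v}) v * F S)
      = (\<Sum>S\<in>Pow ?V. \<Sum>v\<in>?V - S. ?m S * ?\<alpha> S v * F (insert v S))"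
  proof -
    have "(\<Sum>S\<in>Pow ?V. \<Sum>v\<in>?V \<inter> S. ?m (S - {v}) * ?\<alpha> (S - {v}) v * F S)
        = (\<Sum>(S, v)\<in>(SIGMA S:Pow ?V. ?V \<inter> S). ?m (S - {v}) * ?\<alpha> (S - {v}) v * F S)"
      by (rule sum.Sigma) auto
    also have "\<dots> = (\<Sum>(S, v)\<in>(SIGMA S:Pow ?V. ?V - S). ?m S * ?\<alpha> S v * F (insert v S))"
      by (rule sum.reindex_bij_witness[where i="\<lambda>(S, v). (insert v S, v)" and j="\<lambda>(S, v). (S - {v}, v)"])
         (auto simp: insert_absorb)
    also have "\<dots> = (\<Sum>S\<in>Pow ?V. \<Sum>v\<in>?V - S. ?m S * ?\<alpha> S v * F (insert v S))"
      by (rule sum.Sigma[symmetric]) auto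
    finally show ?thesis .
  qed
  have "\<mu> n t (Suc s) S * F S = ?m S * F S - (\<Sum>v\<in>?V - S. ?m S * ?\<alpha> S v * F S)
      + (\<Sum>v\<in>?V \<inter> S. ?m (S - {v}) * ?\<alpha> (S - {v}) v * F S)" for S
    unfolding \<mu>_def past_independent_of_future(2)[OF finite.emptyI empty_subsetI]
      left_diff_distrib distrib_right sum_distrib_right ..
  then have "(\<Sum>S\<in>Pow ?V. \<mu> n t (Suc s) S * F S)
      = (\<Sum>S\<in>Pow ?V. ?m S * F S) - (\<Sum>S\<in>Pow ?V. \<Sum>v\<in>?V - S. ?m S * ?\<alpha> S v * F S)
        + (\<Sum>S\<in>Pow ?V. \<Sum>v\<in>?V \<inter> S. ?m (S - {v}) * ?\<alpha> (S - {v}) v * F S)"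
    by (simp only: sum.distrib sum_subtractf)
  also have "\<dots> = (\<Sum>S\<in>Pow ?V. ?m S * F S - (\<Sum>v\<in>?V - S. ?m S * ?\<alpha> S v * F S)
        + (\<Sum>v\<in>?V - S. ?m S * ?\<alpha> S v * F (insert v S)))"
    unfolding swap by (simp only: sum.distrib sum_subtractf)
  also have "\<dots> = (\<Sum>S\<in>Pow ?V. ?m S * (F S + (\<Sum>v\<in>?V - S. ?\<alpha> S v * (F (insert v S) - F S))))"
    by (intro sum.cong refl)
       (simp add: distrib_left right_diff_distrib sum_subtractf sum_distrib_left mult.assoc)
  finally show ?thesis .
qed

text \<open>A supermartingale bound: by \<open>step\<close> the expectation of \<open>G s\<close>
  does not increase with \<open>s\<close>, it starts at \<open>G 0 {}\<close> because nobody has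
  succeeded before slot 0, and \<open>G T\<close> dominates the indicator that \<open>u\<close> has
  succeeded.\<close>

lemma prob_succeeded_le_potential:
  fixes G :: "nat \<Rightarrow> nat set \<Rightarrow> real"
  assumes "\<And>S. S \<subseteq> {..<n} \<Longrightarrow> u \<in> S \<Longrightarrow> 1 \<le> G T S" "\<And>S. 0 \<le> G T S"
    and step: "\<And>s S. s < T \<Longrightarrow> S \<subseteq> {..<n} \<Longrightarrow>
      G (Suc s) S + (\<Sum>v\<in>{..<n} - S. success_prob n t s S v * (G (Suc s) (insert v S) - G (Suc s) S)) \<le> G s S"
  shows "pr n (\<lambda>x. u \<in> succeeded n t x T) \<le> G 0 {}"
proof -
  interpret P: prob_space "draws D n" by (rule prob_space_draws)
  let ?\<mu> = "\<lambda>s S. pr n (\<lambda>x. succeeded n t x s = S)"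
  have dec: "(\<Sum>S\<in>Pow {..<n}. ?\<mu> s S * G s S) \<le> G 0 {}" if "s \<le> T" for s
    using that
  proof (induction s)
    case 0
    have "?\<mu> 0 S = (if S = {} then 1 else 0)" for S by (simp add: P.prob_space eq_commute)
    then have "(\<Sum>S\<in>Pow {..<n}. ?\<mu> 0 S * G 0 S) = (\<Sum>S\<in>Pow {..<n}. if S = {} then G 0 S else 0)"
      by (intro sum.cong) auto
    then show ?case by (simp add: sum.delta')
  next
    case (Suc s)
    have "(\<Sum>S\<in>Pow {..<n}. ?\<mu> (Suc s) S * G (Suc s) S) \<le> (\<Sum>S\<in>Pow {..<n}. ?\<mu> s S * G s S)"
      unfolding expectation_step using Suc.prems by (intro sum_mono mult_left_mono step) auto
    with Suc show ?case by simp
  qed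
  have "pr n (\<lambda>x. u \<in> succeeded n t x T)
      = measure (draws D n) (\<Union>S\<in>{S \<in> Pow {..<n}. u \<in> S}. {x \<in> space (draws D n). succeeded n t x T = S})"
    by (intro arg_cong[where f="measure (draws D n)"] set_eqI) (simp add: succeeded_subset)
  also have "\<dots> = (\<Sum>S\<in>{S \<in> Pow {..<n}. u \<in> S}. ?\<mu> T S)"
    by (intro P.finite_measure_finite_Union) (auto simp: disjoint_family_on_def)
  also have "\<dots> \<le> (\<Sum>S\<in>{S \<in> Pow {..<n}. u \<in> S}. ?\<mu> T S * G T S)"
  proof (rule sum_mono)
    fix S assume "S \<in> {S \<in> Pow {..<n}. u \<in> S}"
    then have "1 \<le> G T S" using assms(1) by auto
    then show "?\<mu> T S \<le> ?\<mu> T S * G T S" using mult_left_mono[of 1 "G T S" "?\<mu> T S"] by simp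
  qed
  also have "\<dots> \<le> (\<Sum>S\<in>Pow {..<n}. ?\<mu> T S * G T S)"
    using assms(2) by (intro sum_mono2) auto
  finally show ?thesis using dec[of T] by simp
qed

lemma success_prob_le:
  assumes "c \<le> (\<Sum>w\<in>{..<n} - S - {v}. attempt_prob t s w)"
  shows "success_prob n t s S v \<le> attempt_prob t s v * exp (- c)"
proof -
  have "(\<Prod>w\<in>{..<n} - S - {v}. 1 - attempt_prob t s w) \<le> (\<Prod>w\<in>{..<n} - S - {v}. exp (- attempt_prob t s w))"
    using attempt_prob_bounds by (intro prod_mono) (auto intro: order_trans[OF _ exp_ge_add_one_self])
  also have "\<dots> = exp (- (\<Sum>w\<in>{..<n} - S - {v}. attempt_prob t s w))"
    by (simp add: exp_sum[symmetric] sum_negf)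
  also have "\<dots> \<le> exp (- c)" using assms by simp
  finally show ?thesis unfolding success_prob_def
    using attempt_prob_bounds by (intro mult_left_mono) auto
qed

text \<open>Weights below the attempt probabilities certify contention: \<open>S\<close> removes at
  most \<open>a\<close> of \<open>2 * a\<close>, and \<open>v\<close> itself at most 1, which leaves
  \<open>a - 1\<close> for the exponent.\<close>

lemma success_prob_le_of_weights:
  assumes w: "\<And>v. 0 \<le> w v" "\<And>v. w v \<le> attempt_prob t s v"
    and contention: "2 * a \<le> (\<Sum>v<n. w v)" and lost: "(\<Sum>v\<in>S. w v) \<le> a"
    and S: "S \<subseteq> {..<n}"
  shows "success_prob n t s S v \<le> exp (1 - a) * attempt_prob t s v"
proof -
  have "(\<Sum>v<n. w v) = (\<Sum>v\<in>S. w v) + (\<Sum>v\<in>{..<n} - S. w v)"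
    using S by (metis add.commute finite_lessThan sum.subset_diff)
  moreover have "(\<Sum>v\<in>{..<n} - S. w v) \<le> (\<Sum>v\<in>{..<n} - S - {v}. w v) + 1"
  proof (cases "v \<in> {..<n} - S")
    case True
    have "w v \<le> 1" using w(2)[of v] attempt_prob_bounds(2)[of t s v] by linarith
    with True show ?thesis by (subst sum.remove[of _ v]) auto
  qed simp
  moreover have "(\<Sum>v\<in>{..<n} - S - {v}. w v) \<le> (\<Sum>v\<in>{..<n} - S - {v}. attempt_prob t s v)"
    by (intro sum_mono w)
  ultimately have "a - 1 \<le> (\<Sum>w\<in>{..<n} - S - {v}. attempt_prob t s w)"
    using contention lost by linarith
  from success_prob_le[OF this] show ?thesis by (simp add: mult.commute)
qed

text \<open>As long as the parties removed so far carry weight at most \<open>a\<close>, every success has probability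
  at most \<open>exp (1 - a)\<close> times that of the attempt. The exponential moments of the lost weight,
  one for each future slot, together with the expected number of attempts of \<open>u\<close>, therefore
  form a supermartingale.\<close>

lemma prob_success_le:
  fixes w :: "nat \<Rightarrow> nat \<Rightarrow> real" and a \<theta> :: real
  assumes u: "u < n" and \<theta>: "0 \<le> \<theta>"
    and w: "\<And>s v. 0 \<le> w s v" "\<And>s v. s < T \<Longrightarrow> w s v \<le> attempt_prob t s v"
    and contention: "\<And>s v. s < T \<Longrightarrow> v < n \<Longrightarrow> 0 < attempt_prob t s v \<Longrightarrow> 2 * a \<le> (\<Sum>v<n. w s v)"
  defines "q \<equiv> exp (1 - a)"
  shows "pr n (\<lambda>x. u \<in> succeeded n t x T) \<le> q * (\<Sum>s<T. attempt_prob t s u)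
     + (\<Sum>s<T. exp (q * (\<Sum>r<s. \<Sum>v<n. attempt_prob t r v * (exp (\<theta> * w s v) - 1)) - \<theta> * a))"
proof -
  define A where "A = attempt_prob t"
  define lost where "lost = (\<lambda>s S. \<Sum>v\<in>S. w s v)"
  define \<omega> where "\<omega> = (\<lambda>s v. exp (\<theta> * w s v) - 1)"
  \<comment> \<open>Seen from slot \<open>r0\<close>, an exponential bound for the event that the
    weight lost for slot \<open>s\<close> comes to exceed \<open>a\<close>; the sum compensates the
    growth still possible in the slots from \<open>r0\<close> to \<open>s - 1\<close>.\<close>
  define E where "E = (\<lambda>r0 s S. exp (\<theta> * (lost s S - a) + q * (\<Sum>r\<in>{r0..<s}. \<Sum>v<n. A r v * \<omega> s v)))"
  define U where "U = (\<lambda>r0 S. q * (\<Sum>s\<in>{r0..<T}. A s u) + (\<Sum>s\<in>{r0..<T}. E r0 s S))"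
  \<comment> \<open>Capping at 1 leaves the drift inequality to be checked only where
    \<open>U\<close> is below 1, which is where little weight has been lost.\<close>
  define G where "G = (\<lambda>r0 S. if u \<in> S then 1 else min 1 (U r0 S))"
  have A: "0 \<le> A s v" for s v unfolding A_def by (rule attempt_prob_bounds)
  have q: "0 \<le> q" by (simp add: q_def)
  have \<omega>: "0 \<le> \<omega> s v" for s v unfolding \<omega>_def using \<theta> w(1) by simp
  have E: "0 \<le> E r0 s S" for r0 s S by (simp add: E_def)
  have U: "0 \<le> U r0 S" for r0 S
    unfolding U_def using A E q by (intro add_nonneg_nonneg mult_nonneg_nonneg sum_nonneg) auto
  have G: "0 \<le> G r0 S" "G r0 S \<le> 1" "u \<notin> S \<Longrightarrow> G r0 S \<le> U r0 S" for r0 S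
    using U by (auto simp: G_def)
  have step: "G (Suc s) S + (\<Sum>v\<in>{..<n} - S. success_prob n t s S v * (G (Suc s) (insert v S) - G (Suc s) S)) \<le> G s S"
    (is "?lhs \<le> _") if s: "s < T" and S: "S \<subseteq> {..<n}" for s S
  proof (cases "u \<in> S")
    case True
    then show ?thesis by (simp add: G_def)
  next
    case uS: False
    let ?\<alpha> = "success_prob n t s S"
    have lhs: "?lhs = (1 - (\<Sum>v\<in>{..<n} - S. ?\<alpha> v)) * G (Suc s) S + (\<Sum>v\<in>{..<n} - S. ?\<alpha> v * G (Suc s) (insert v S))"
      by (simp add: algebra_simps sum_subtractf sum_distrib_left)
    note \<alpha>1 = sum_success_prob_le_1[of n t s S]
    have le1: "?lhs \<le> 1"
    proof -
      have "?lhs \<le> (1 - (\<Sum>v\<in>{..<n} - S. ?\<alpha> v)) * 1 + (\<Sum>v\<in>{..<n} - S. ?\<alpha> v * 1)"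
        unfolding lhs using \<alpha>1 G success_prob_nonneg
        by (intro add_mono mult_left_mono sum_mono) auto
      then show ?thesis by simp
    qed
    show ?thesis
    proof (cases "1 \<le> U s S")
      case True
      then show ?thesis using le1 uS by (simp add: G_def)
    next
      case False
      \<comment> \<open>The compensator in \<open>E s s S\<close> is an empty sum, so
        \<open>E s s S < 1\<close> says that the weight lost for slot \<open>s\<close> is still at
        most \<open>a\<close>.\<close>
      have "E s s S \<le> (\<Sum>r\<in>{s..<T}. E s r S)"
        using s E by (intro member_le_sum) auto
      also have "\<dots> \<le> U s S" unfolding U_def using A q by (simp add: sum_nonneg)
      finally have "E s s S < 1" using False by simp
      then have "\<theta> * (lost s S - a) < 0" by (simp add: E_def)
      then have lost: "lost s S \<le> a" using \<theta> by (simp add: mult_less_0_iff)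
      \<comment> \<open>Contention is assumed only for parties that may attempt; for the others both
        sides vanish.\<close>
      have \<alpha>: "?\<alpha> v \<le> q * A s v" if "v < n" for v
      proof (cases "0 < A s v")
        case True
        then show ?thesis unfolding q_def A_def
          using s S lost w contention[OF s that] unfolding lost_def A_def
          by (intro success_prob_le_of_weights[where w="w s"]) auto
      next
        case False
        then have "A s v = 0" using A[of s v] by simp
        then show ?thesis by (simp add: success_prob_def A_def)
      qed
      have E_insert: "E (Suc s) r (insert v S) - E (Suc s) r S = E (Suc s) r S * \<omega> r v" if "v \<in> {..<n} - S" for r v
      proof -
        have "finite S" using S finite_subset by blast
        then have "lost r (insert v S) = lost r S + w r v" using that by (simp add: lost_def)
        then have "E (Suc s) r (insert v S) = exp (\<theta> * w r v) * E (Suc s) r S"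
          unfolding E_def exp_add[symmetric] by (intro arg_cong[where f=exp]) (simp add: distrib_left right_diff_distrib)
        then show ?thesis by (simp add: \<omega>_def algebra_simps)
      qed
      have E_step: "E (Suc s) r S + (\<Sum>v\<in>{..<n} - S. ?\<alpha> v * (E (Suc s) r (insert v S) - E (Suc s) r S)) \<le> E s r S"
        if r: "r \<in> {Suc s..<T}" for r
      proof -
        have "(\<Sum>v\<in>{..<n} - S. ?\<alpha> v * (E (Suc s) r (insert v S) - E (Suc s) r S))
            = (\<Sum>v\<in>{..<n} - S. ?\<alpha> v * \<omega> r v) * E (Suc s) r S"
          unfolding sum_distrib_right by (intro sum.cong) (simp_all add: E_insert)
        also have "\<dots> \<le> (q * (\<Sum>v<n. A s v * \<omega> r v)) * E (Suc s) r S"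
        proof (rule mult_right_mono[OF _ E])
          have "(\<Sum>v\<in>{..<n} - S. ?\<alpha> v * \<omega> r v) \<le> (\<Sum>v\<in>{..<n} - S. q * A s v * \<omega> r v)"
            using \<alpha> \<omega> by (intro sum_mono mult_right_mono) auto
          also have "\<dots> \<le> (\<Sum>v<n. q * A s v * \<omega> r v)"
            using A q \<omega> by (intro sum_mono2) auto
          finally show "(\<Sum>v\<in>{..<n} - S. ?\<alpha> v * \<omega> r v) \<le> q * (\<Sum>v<n. A s v * \<omega> r v)"
            by (simp add: sum_distrib_left mult.assoc)
        qed
        finally have "E (Suc s) r S + (\<Sum>v\<in>{..<n} - S. ?\<alpha> v * (E (Suc s) r (insert v S) - E (Suc s) r S))
            \<le> (1 + q * (\<Sum>v<n. A s v * \<omega> r v)) * E (Suc s) r S"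
          by (simp add: algebra_simps)
        \<comment> \<open>The exponent is the summand by which the compensator of \<open>E s\<close>
          exceeds that of \<open>E (Suc s)\<close>.\<close>
        also have "\<dots> \<le> exp (q * (\<Sum>v<n. A s v * \<omega> r v)) * E (Suc s) r S"
          using E by (intro mult_right_mono exp_ge_add_one_self)
        also have "\<dots> = E s r S"
        proof -
          have "{s..<r} = insert s {Suc s..<r}" using r by auto
          then show ?thesis unfolding E_def by (simp add: exp_add[symmetric] algebra_simps)
        qed
        finally show ?thesis .
      qed
      \<comment> \<open>\<open>G\<close> jumps to 1 when \<open>u\<close> itself succeeds, which
        \<open>U\<close> does not record; the probability of this jump is paid for by the first sum
        in \<open>U\<close>.\<close>
      have "?lhs \<le> (1 - (\<Sum>v\<in>{..<n} - S. ?\<alpha> v)) * U (Suc s) S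
          + (\<Sum>v\<in>{..<n} - S. ?\<alpha> v * (U (Suc s) (insert v S) + (if v = u then 1 else 0)))"
        unfolding lhs
      proof (intro add_mono mult_left_mono sum_mono)
        fix v
        show "G (Suc s) (insert v S) \<le> U (Suc s) (insert v S) + (if v = u then 1 else 0)"
          using G(2)[of "Suc s" "insert v S"] G(3)[of "insert v S" "Suc s"] U[of "Suc s" "insert v S"] uS by auto
      qed (use \<alpha>1 G uS success_prob_nonneg in auto)
      also have "\<dots> = ?\<alpha> u + (U (Suc s) S + (\<Sum>v\<in>{..<n} - S. ?\<alpha> v * (U (Suc s) (insert v S) - U (Suc s) S)))"
      proof -
        have "(\<Sum>v\<in>{..<n} - S. ?\<alpha> v * (if v = u then 1 else 0)) = ?\<alpha> u"
          using u uS by (simp add: if_distrib[of "\<lambda>x. _ * x"] sum.delta' cong: if_cong)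
        then show ?thesis by (simp add: algebra_simps sum.distrib sum_subtractf sum_distrib_left)
      qed
      also have "U (Suc s) S + (\<Sum>v\<in>{..<n} - S. ?\<alpha> v * (U (Suc s) (insert v S) - U (Suc s) S))
          = q * (\<Sum>s\<in>{Suc s..<T}. A s u) + (\<Sum>r\<in>{Suc s..<T}. E (Suc s) r S
              + (\<Sum>v\<in>{..<n} - S. ?\<alpha> v * (E (Suc s) r (insert v S) - E (Suc s) r S)))"
        unfolding U_def
        by (simp add: sum.distrib sum_subtractf[symmetric] sum_distrib_left sum.swap[of _ "{..<n} - S"])
      also have "\<dots> \<le> q * (\<Sum>s\<in>{Suc s..<T}. A s u) + (\<Sum>r\<in>{Suc s..<T}. E s r S)"
        by (intro add_left_mono sum_mono E_step)
      also have "?\<alpha> u + \<dots> \<le> U s S"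
      proof -
        have *: "{s..<T} = insert s {Suc s..<T}" using s by auto
        show ?thesis unfolding U_def * using \<alpha>[OF u] E[of s s S] by (simp add: algebra_simps)
      qed
      finally have "?lhs \<le> U s S" by simp
      with le1 uS show ?thesis by (simp add: G_def)
    qed
  qed
  have "pr n (\<lambda>x. u \<in> succeeded n t x T) \<le> G 0 {}"
    by (rule prob_succeeded_le_potential[of n u G T t, OF _ _ step]) (auto simp: G_def U)
  also have "\<dots> \<le> U 0 {}" by (simp add: G_def)
  finally show ?thesis
    unfolding U_def E_def A_def \<omega>_def lost_def by (simp add: atLeast0LessThan algebra_simps)
qed

end

section \<open>Noise of nearly constant contention\<close>

text \<open>The method of conditional expectations: some choice does at least as well as the average over
  independent uniform choices.\<close>

lemma ex_choice_prod_le_average: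
  fixes F :: "nat \<Rightarrow> nat \<Rightarrow> 'i \<Rightarrow> real"
  assumes "0 < g" "\<And>i. i \<in> I \<Longrightarrow> 0 \<le> c i"
  shows "\<exists>f. (\<forall>k. f k < g) \<and>
    (\<Sum>i\<in>I. c i * (\<Prod>k<K. F k (f k) i)) \<le> (\<Sum>i\<in>I. c i * (\<Prod>k<K. (\<Sum>j<g. F k j i) / g))"
proof (induction K arbitrary: c)
  case 0
  then show ?case using assms by auto
next
  case (Suc K)
  let ?avg = "\<lambda>k i. (\<Sum>j<g. F k j i) / g"
  obtain f where f: "\<forall>k. f k < g" and
    le: "(\<Sum>i\<in>I. c i * ?avg K i * (\<Prod>k<K. F k (f k) i)) \<le> (\<Sum>i\<in>I. c i * ?avg K i * (\<Prod>k<K. ?avg k i))"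
    using Suc[of "\<lambda>i. c i * ?avg K i"] by auto
  \<comment> \<open>\<open>a j\<close> is the sum with last choice \<open>j\<close>. The earlier
    choices come from the induction hypothesis, applied with the average of the last factor absorbed
    into the weights; some \<open>j\<close> does no worse than the average of
    \<open>a\<close>.\<close>
  define a where "a = (\<lambda>j. \<Sum>i\<in>I. c i * F K j i * (\<Prod>k<K. F k (f k) i))"
  have "(\<Sum>j<g. a j) / g = (\<Sum>i\<in>I. c i * ?avg K i * (\<Prod>k<K. F k (f k) i))"
    unfolding a_def by (subst sum.swap) (simp add: sum_distrib_left sum_distrib_right sum_divide_distrib)
  moreover have "\<exists>j<g. a j \<le> (\<Sum>j<g. a j) / g"
  proof (rule ccontr)
    assume "\<not> ?thesis"
    then have "(\<Sum>j<g. (\<Sum>j<g. a j) / g) < (\<Sum>j<g. a j)"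
      using assms(1) by (intro sum_strict_mono) (auto simp: not_le)
    then show False using assms(1) by simp
  qed
  ultimately obtain j where j: "j < g" "a j \<le> (\<Sum>i\<in>I. c i * ?avg K i * (\<Prod>k<K. ?avg k i))"
    using le by auto
  have "(\<Sum>i\<in>I. c i * (\<Prod>k<Suc K. F k ((f(K := j)) k) i)) = a j"
    unfolding a_def by (intro sum.cong) (auto simp: mult_ac)
  then show ?case using f j by (intro exI[of _ "f(K := j)"]) (auto simp: mult_ac)
qed

lemma exp_le_one_plus_double: "exp x \<le> 1 + 2 * x" if "0 \<le> x" "x \<le> 1" for x :: real
proof -
  have "x\<^sup>2 \<le> x" using that by (simp add: power2_eq_square mult_left_le)
  with exp_bound[OF that] show ?thesis by simp
qed

lemma exp_minus_le_one_minus_half: "exp (- x) \<le> 1 - x / 2" if "0 \<le> x" "x \<le> 1" for x :: real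
proof -
  have "x * x \<le> x" using that by (simp add: mult_left_le)
  then have "1 \<le> (1 + x) * (1 - x / 2)" by (simp add: algebra_simps)
  also have "\<dots> \<le> exp x * (1 - x / 2)"
    using that by (intro mult_right_mono exp_ge_add_one_self) auto
  finally show ?thesis by (simp add: exp_minus field_simps)
qed

lemma average_exp_le:
  fixes x :: "nat \<Rightarrow> real"
  assumes "0 < g" "\<And>j. j < g \<Longrightarrow> exp (x j) \<le> 1 + y j"
  shows "(\<Sum>j<g. exp (x j)) / g \<le> exp ((\<Sum>j<g. y j) / g)"
proof -
  have "(\<Sum>j<g. exp (x j)) / g \<le> (\<Sum>j<g. 1 + y j) / g"
    using assms by (intro divide_right_mono sum_mono) auto
  also have "\<dots> = 1 + (\<Sum>j<g. y j) / g"
    using assms(1) by (simp add: sum.distrib add_divide_distrib)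
  also have "\<dots> \<le> exp ((\<Sum>j<g. y j) / g)" by (rule exp_ge_add_one_self)
  finally show ?thesis .
qed

text \<open>A Chernoff bound for one wake-up at a uniform offset in each block of \<open>g\<close>
  slots, with exponent \<open>1 / h\<close> because single terms are at most \<open>h\<close>. Both
  tails of all slots are summed into one average, so that one choice of offsets serves them
  all.\<close>

lemma ex_balanced_schedule:
  fixes l :: "nat \<Rightarrow> real"
  assumes h: "0 < h" and l: "\<And>i. 0 \<le> l i" "\<And>i. l i \<le> h" "l 0 = 0" "\<And>i. m < i \<Longrightarrow> l i = 0"
    and g: "0 < g"
  defines "load \<equiv> (\<Sum>i\<in>{1..m}. l i) / g"
  shows "\<exists>f. (\<forall>k. f k < g) \<and> (\<forall>s\<in>{m..g * K}.
    load / 2 - h * ln (2 * real (g * K + 1)) \<le> (\<Sum>k<K. l (s - (g * k + f k))) \<and>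
    (\<Sum>k<K. l (s - (g * k + f k))) \<le> 2 * load + h * ln (2 * real (g * K + 1)))"
proof -
  define I where "I = (UNIV :: bool set) \<times> {m..g * K}"
  \<comment> \<open>The two values cancel the averages of the exponential moments, so every summand
    averages to at most 1; \<open>True\<close> marks the upper tail, \<open>False\<close> the lower
    one.\<close>
  define c where "c = (\<lambda>(b, s :: nat). if b then exp (- (2 * load / h)) else exp (load / (2 * h)))"
  define F where "F = (\<lambda>k j (b, s). exp ((if b then 1 else - 1) * l (s - (g * k + j)) / h))"
  have c: "0 \<le> c i" for i by (simp add: c_def split: prod.splits)
  obtain f where f: "\<forall>k. f k < g" and
    le: "(\<Sum>i\<in>I. c i * (\<Prod>k<K. F k (f k) i)) \<le> (\<Sum>i\<in>I. c i * (\<Prod>k<K. (\<Sum>j<g. F k j i) / g))"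
    using ex_choice_prod_le_average[OF g, where c=c and I=I and K=K and F=F] c by blast
  \<comment> \<open>The blocks exhaust the slots below \<open>g * K\<close>, and a full window of
    \<open>m\<close> slots lies before \<open>s\<close>. Slots from \<open>s\<close> on contribute
    \<open>l 0 = 0\<close> by truncated subtraction.\<close>
  have total: "(\<Sum>k<K. \<Sum>j<g. l (s - (g * k + j))) = (\<Sum>i\<in>{1..m}. l i)" if "s \<in> {m..g * K}" for s
  proof -
    have "(\<Sum>j<g. l (s - (g * k + j))) = (\<Sum>j\<in>{k * g..<k * g + g}. l (s - j))" for k
      by (rule sum.reindex_bij_witness[where i="\<lambda>j. j - k * g" and j="\<lambda>j. k * g + j"])
         (auto simp: mult.commute)
    then have "(\<Sum>k<K. \<Sum>j<g. l (s - (g * k + j))) = (\<Sum>k<K. \<Sum>j\<in>{k * g..<k * g + g}. l (s - j))"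
      by simp
    also have "\<dots> = (\<Sum>j<g * K. l (s - j))" by (simp add: sum.nat_group mult.commute)
    also have "\<dots> = (\<Sum>j\<in>{s - m..<s}. l (s - j))"
      using that l(3,4) by (intro sum.mono_neutral_right) (auto simp: not_less not_le)
    also have "\<dots> = (\<Sum>i\<in>{1..m}. l i)"
      using that by (intro sum.reindex_bij_witness[where i="\<lambda>i. s - i" and j="\<lambda>j. s - j"]) auto
    finally show ?thesis .
  qed
  have "(\<Prod>k<K. (\<Sum>j<g. F k j (b, s)) / g) \<le> exp ((if b then 2 else - 1 / 2) * load / h)"
    if s: "s \<in> {m..g * K}" for b s
  proof -
    let ?e = "if b then 2 else - 1 / 2 :: real"
    have "(\<Prod>k<K. (\<Sum>j<g. F k j (b, s)) / g) \<le> (\<Prod>k<K. exp ((\<Sum>j<g. ?e * l (s - (g * k + j)) / h) / g))"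
    proof (intro prod_mono conjI)
      fix k
      show "0 \<le> (\<Sum>j<g. F k j (b, s)) / g" by (intro divide_nonneg_nonneg sum_nonneg) (auto simp: F_def)
      show "(\<Sum>j<g. F k j (b, s)) / g \<le> exp ((\<Sum>j<g. ?e * l (s - (g * k + j)) / h) / g)"
        unfolding F_def prod.case
      proof (rule average_exp_le[OF g])
        fix j
        have "0 \<le> l (s - (g * k + j)) / h" "l (s - (g * k + j)) / h \<le> 1" using l(1,2) h by auto
        from exp_le_one_plus_double[OF this] exp_minus_le_one_minus_half[OF this]
        show "exp ((if b then 1 else - 1) * l (s - (g * k + j)) / h) \<le> 1 + ?e * l (s - (g * k + j)) / h"
          by auto
      qed
    qed
    also have "\<dots> = exp (\<Sum>k<K. (\<Sum>j<g. ?e * l (s - (g * k + j)) / h) / g)"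
      by (simp add: exp_sum)
    also have "(\<Sum>k<K. (\<Sum>j<g. ?e * l (s - (g * k + j)) / h) / g) = ?e * load / h"
      unfolding load_def total[OF s, symmetric] by (simp add: sum_distrib_left sum_divide_distrib mult_ac)
    finally show ?thesis .
  qed
  note avg = this
  have "c i * (\<Prod>k<K. (\<Sum>j<g. F k j i) / g) \<le> 1" if iI: "i \<in> I" for i
  proof -
    obtain b s where i: "i = (b, s)" "s \<in> {m..g * K}" using iI unfolding I_def by blast
    have "c i * (\<Prod>k<K. (\<Sum>j<g. F k j i) / g) \<le> c i * exp ((if b then 2 else - 1 / 2) * load / h)"
      unfolding i(1) by (intro mult_left_mono avg i(2)) (auto simp: c_def)
    also have "\<dots> = 1" by (auto simp: i(1) c_def exp_add[symmetric])
    finally show ?thesis .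
  qed
  then have "(\<Sum>i\<in>I. c i * (\<Prod>k<K. (\<Sum>j<g. F k j i) / g)) \<le> real (card I)"
    using sum_bounded_above[of I _ "1 :: real"] by simp
  also have "real (card I) \<le> real (2 * (g * K + 1))"
    by (rule of_nat_mono) (simp add: I_def card_cartesian_product)
  also have "\<dots> = 2 * real (g * K + 1)" by simp
  finally have bound: "(\<Sum>i\<in>I. c i * (\<Prod>k<K. F k (f k) i)) \<le> 2 * real (g * K + 1)" using le by linarith
  \<comment> \<open>A nonnegative summand is at most the whole sum, so the logarithm of the number
    of tail events bounds every deviation, in units of \<open>h\<close>.\<close>
  have each: "c (b, s) * exp ((if b then 1 else - 1) * (\<Sum>k<K. l (s - (g * k + f k))) / h) \<le> 2 * real (g * K + 1)"
    if s: "s \<in> {m..g * K}" for b s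
  proof -
    have "c (b, s) * exp ((if b then 1 else - 1) * (\<Sum>k<K. l (s - (g * k + f k))) / h)
        = c (b, s) * (\<Prod>k<K. F k (f k) (b, s))"
      by (simp add: F_def exp_sum[symmetric] sum_divide_distrib sum_negf)
    also have "\<dots> \<le> (\<Sum>i\<in>I. c i * (\<Prod>k<K. F k (f k) i))"
      using s by (intro member_le_sum[where i="(b, s)" and f="\<lambda>i. c i * (\<Prod>k<K. F k (f k) i)"]
        mult_nonneg_nonneg prod_nonneg c) (auto simp: I_def F_def)
    finally show ?thesis using bound by linarith
  qed
  have "load / 2 - h * ln (2 * real (g * K + 1)) \<le> (\<Sum>k<K. l (s - (g * k + f k))) \<and>
    (\<Sum>k<K. l (s - (g * k + f k))) \<le> 2 * load + h * ln (2 * real (g * K + 1))"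
    (is "_ - ?L \<le> ?X \<and> _") if s: "s \<in> {m..g * K}" for s
  proof -
    have ln: "y \<le> ln (2 * real (g * K + 1))" if "exp y \<le> 2 * real (g * K + 1)" for y
      using that by (subst ln_ge_iff) (auto intro: add_pos_nonneg)
    have "?X / h - 2 * load / h \<le> ln (2 * real (g * K + 1))"
      using each[OF s, of True] by (intro ln) (simp add: c_def exp_diff exp_minus field_simps)
    moreover have "load / (2 * h) - ?X / h \<le> ln (2 * real (g * K + 1))"
      using each[OF s, of False] by (intro ln) (simp add: c_def exp_diff exp_minus field_simps)
    ultimately show ?thesis using h by (simp add: field_simps)
  qed
  with f show ?thesis by blast
qed

section \<open>Noise and the expected latency\<close>

lemma succeeded_mono: "s \<le> s' \<Longrightarrow> succeeded n t x s \<subseteq> succeeded n t x s'"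
  by (rule lift_Suc_mono_le[of "succeeded n t x"]) auto

lemma latency_ge:
  assumes "u \<notin> succeeded n t x T" "t u = 0"
  shows "enat T \<le> latency n t x u"
proof -
  have "enat T \<le> success_slot n t x u"
    unfolding success_slot_def
  proof (rule Inf_greatest)
    fix y assume "y \<in> {enat s |s. attempting n t x s = {u}}"
    then obtain s where s: "y = enat s" "attempting n t x s = {u}" by auto
    have "\<not> s < T"
    proof
      assume "s < T"
      have "u \<in> succeeded n t x (Suc s)" using s(2) by (simp add: attempting_def)
      with succeeded_mono[of "Suc s" T n t x] \<open>s < T\<close> assms(1) show False by auto
    qed
    with s(1) show "enat T \<le> y" by simp
  qed
  then show ?thesis using assms(2) by (simp add: latency_def zero_enat_def[symmetric])
qed

definition mass :: "(nat \<Rightarrow> real) \<Rightarrow> nat \<Rightarrow> real" where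
  "mass p m = (\<Sum>i\<in>{1..m}. p i)"

text \<open>The cutoff supplies the bound on single terms that the exponential moments need; heavy
  local times will be few enough to be jammed instead.\<close>

definition light_part :: "real \<Rightarrow> (nat \<Rightarrow> real) \<Rightarrow> nat \<Rightarrow> real" where
  "light_part h p i = (if p i \<le> h then p i else 0)"

context memoryless_protocol
begin

text \<open>Remaining unsuccessful before slot \<open>T\<close> forces latency at least
  \<open>T\<close>, and this has probability at least 1/2.\<close>

lemma L_exp_ge:
  assumes "u < n" "t u = 0" and pr: "pr n (\<lambda>x. u \<in> succeeded n t x T) \<le> 1 / 2"
  shows "ennreal (real T / 2) \<le> L_exp D n"
proof -
  interpret P: prob_space "draws D n" by (rule prob_space_draws)
  let ?E = "{x \<in> space (draws D n). u \<notin> succeeded n t x T}"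
  have set: "{x \<in> space (draws D n). u \<in> succeeded n t x T} \<in> sets (draws D n)"
    using pred_succeeded by measurable
  have E: "?E = space (draws D n) - {x \<in> space (draws D n). u \<in> succeeded n t x T}" by auto
  then have E_sets: "?E \<in> sets (draws D n)" using set by auto
  have "1 / 2 \<le> measure (draws D n) ?E"
    unfolding E using P.prob_compl[OF set] pr by simp
  from mult_left_mono[OF this, of "real T"]
  have "ennreal (real T / 2) \<le> ennreal (real T) * emeasure (draws D n) ?E"
    unfolding P.emeasure_eq_measure by (subst ennreal_mult[symmetric]) (auto intro!: ennreal_leI)
  also have "\<dots> = (\<integral>\<^sup>+ x. ennreal (real T) * indicator ?E x \<partial>draws D n)"
    using E_sets by (simp add: nn_integral_cmult_indicator)
  also have "\<dots> \<le> (\<integral>\<^sup>+ x. ennreal_of_enat (latency n t x u) \<partial>draws D n)"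
  proof (rule nn_integral_mono)
    fix x
    show "ennreal (real T) * indicator ?E x \<le> ennreal_of_enat (latency n t x u)"
    proof (cases "u \<in> succeeded n t x T")
      case False
      have "ennreal (real T) = ennreal_of_enat (enat T)" by (simp add: ennreal_of_nat_eq_real_of_nat)
      also have "\<dots> \<le> ennreal_of_enat (latency n t x u)"
        using latency_ge[of u n t x T, OF False assms(2)] by (simp only: ennreal_of_enat_le_iff)
      finally show ?thesis by (auto simp: indicator_def)
    qed simp
  qed
  also have "\<dots> \<le> (MAX u\<in>{..<n}. \<integral>\<^sup>+ x. ennreal_of_enat (latency n t x u) \<partial>draws D n)"
    using assms(1) by (intro Max_ge) auto
  also have "\<dots> \<le> L_exp D n" unfolding L_exp_def by (rule SUP_upper) simp
  finally show ?thesis .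
qed

lemma sum_attempt_prob_le: "(\<Sum>r<s. attempt_prob t r v) \<le> mass p s"
proof -
  have "(\<Sum>r<s. attempt_prob t r v) = (\<Sum>r\<in>{Suc (t v)..<s}. p (r - t v))"
    by (rule sum.mono_neutral_cong_right) (auto simp: attempt_prob_def)
  also have "\<dots> = (\<Sum>i\<in>(\<lambda>r. r - t v) ` {Suc (t v)..<s}. p i)"
    by (subst sum.reindex) (auto simp: inj_on_def)
  also have "\<dots> \<le> mass p s"
    unfolding mass_def using p_nonneg by (intro sum_mono2) auto
  finally show ?thesis .
qed

lemma mass_mono: "a \<le> b \<Longrightarrow> mass p a \<le> mass p b"
  unfolding mass_def using p_nonneg by (intro sum_mono2) auto

text \<open>Party 0 wakes up in slot 0, together with one party in every block of \<open>g\<close> slots. The light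
  attempts of the latter keep the contention of order \<open>\<beta>\<close> once \<open>m\<close> slots have passed. Before
  that, each slot is jammed by \<open>M\<close> parties for which it is the first slot in which
  they may attempt at all, so that none of them can have succeeded earlier.\<close>

lemma L_exp_ge_of_noise:
  fixes \<beta> h :: real and K M m n j0 :: nat
  assumes j0: "1 \<le> j0" "0 < p j0" "\<And>i. 1 \<le> i \<Longrightarrow> i < j0 \<Longrightarrow> p i = 0"
    and h: "0 < h" and \<beta>: "0 < \<beta>" "\<beta> \<le> mass (light_part h p) m"
    and M: "\<beta> / 4 \<le> real M * p j0" and n: "1 + K + M * m \<le> n"
  defines "T \<equiv> K * nat \<lfloor>mass (light_part h p) m / \<beta>\<rfloor>"
  assumes massT: "exp (1 - \<beta> / 8) * mass p T \<le> 1 / 160"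
    and hT: "h * ln (2 * (real T + 1)) \<le> \<beta> / 64"
  shows "ennreal (real T / 2) \<le> L_exp D n"
proof -
  define g where "g = nat \<lfloor>mass (light_part h p) m / \<beta>\<rfloor>"
  define l where "l = (\<lambda>i. if i \<in> {1..m} then light_part h p i else 0)"
  define load where "load = (\<Sum>i\<in>{1..m}. l i) / g"
  have T: "T = g * K" by (simp add: T_def g_def)
  have load_sum: "(\<Sum>i\<in>{1..m}. l i) = mass (light_part h p) m" by (simp add: l_def mass_def)
  have ge1: "1 \<le> mass (light_part h p) m / \<beta>" using \<beta> by simp
  then have g: "0 < g" unfolding g_def by linarith
  have "real g \<le> mass (light_part h p) m / \<beta>" "mass (light_part h p) m / \<beta> \<le> 2 * real g"
  proof -
    have "1 \<le> \<lfloor>mass (light_part h p) m / \<beta>\<rfloor>" using ge1 by linarith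
    then have "real g = of_int \<lfloor>mass (light_part h p) m / \<beta>\<rfloor>" "1 \<le> real g" using g by (simp_all add: g_def)
    then show "real g \<le> mass (light_part h p) m / \<beta>" "mass (light_part h p) m / \<beta> \<le> 2 * real g" by linarith+
  qed
  then have load: "\<beta> \<le> load" "load \<le> 2 * \<beta>"
    unfolding load_def load_sum using g \<beta> by (simp_all add: field_simps)
  have l: "0 \<le> l i" "l i \<le> h" "l 0 = 0" "l i \<le> p i" for i
    using p_nonneg h by (auto simp: l_def light_part_def)
  have l_large: "l i = 0" if "m < i" for i using that by (simp add: l_def)
  obtain f where f: "\<forall>k. f k < g" and bal: "\<forall>s\<in>{m..g * K}.
      load / 2 - h * ln (2 * real (g * K + 1)) \<le> (\<Sum>k<K. l (s - (g * k + f k))) \<and>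
      (\<Sum>k<K. l (s - (g * k + f k))) \<le> 2 * load + h * ln (2 * real (g * K + 1))"
    using ex_balanced_schedule[of h l m g K, OF h l(1-3) l_large g] unfolding load_def by blast
  \<comment> \<open>The load lies between \<open>\<beta>\<close> and \<open>2 * \<beta>\<close>, and
    the deviation term is at most \<open>\<beta> / 64\<close>.\<close>
  have noise: "\<beta> / 4 \<le> (\<Sum>k<K. l (s - (g * k + f k)))" "(\<Sum>k<K. l (s - (g * k + f k))) \<le> 5 * \<beta>"
    if "m \<le> s" "s < T" for s
  proof -
    have "h * ln (2 * real (g * K + 1)) \<le> \<beta> / 64" using hT by (simp add: T algebra_simps)
    then show "\<beta> / 4 \<le> (\<Sum>k<K. l (s - (g * k + f k)))" "(\<Sum>k<K. l (s - (g * k + f k))) \<le> 5 * \<beta>"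
      using bal[rule_format, of s] that load \<beta>(1) by (auto simp: T)
  qed
  \<comment> \<open>Parties 1 to \<open>K\<close> make the noise; the next \<open>M * m\<close> are
    jammers, \<open>M\<close> of them waking up in each slot below \<open>m\<close>. Surplus parties
    wake up at \<open>T\<close>, too late to matter.\<close>
  define t where "t = (\<lambda>v. if v = 0 then 0 else if v \<le> K then g * (v - 1) + f (v - 1)
    else if v \<le> K + M * m then (v - Suc K) div M else T)"
  \<comment> \<open>Before slot \<open>m\<close> only the jammers whose first possible attempt is in
    slot \<open>s\<close> count, afterwards only the light attempts of the noise.\<close>
  define w where "w = (\<lambda>s v. if s < m then if K < v \<and> v \<le> K + M * m \<and> t v + j0 = s then p j0 else 0
    else if 1 \<le> v \<and> v \<le> K then l (s - t v) else 0)"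
  have w_nonneg: "0 \<le> w s v" for s v using l(1) p_nonneg by (simp add: w_def)
  have w_le: "w s v \<le> attempt_prob t s v" for s v
    using l(3) l(4)[of "s - t v"] j0(1) p_nonneg by (auto simp: w_def attempt_prob_def)
  have w_noise: "(\<Sum>v<n. w s v) = (\<Sum>k<K. l (s - (g * k + f k)))" if "\<not> s < m" for s
  proof -
    have "(\<Sum>v<n. w s v) = (\<Sum>v\<in>{1..K}. l (s - t v))"
      using n that by (intro sum.mono_neutral_cong_right) (auto simp: w_def)
    also have "\<dots> = (\<Sum>k<K. l (s - t (Suc k)))"
      by (rule sum.reindex_bij_witness[where i=Suc and j="\<lambda>v. v - 1"]) auto
    also have "\<dots> = (\<Sum>k<K. l (s - (g * k + f k)))" by (simp add: t_def)
    finally show ?thesis .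
  qed
  have contention: "2 * (\<beta> / 8) \<le> (\<Sum>v<n. w s v)" if s: "s < T" and A: "0 < attempt_prob t s v" for s v
  proof (cases "s < m")
    case False
    then show ?thesis using noise(1)[of s] s w_noise by simp
  next
    case True
    \<comment> \<open>A party that can attempt in slot \<open>s\<close> has been awake for at least
      \<open>j0\<close> slots, so the jammers meant for slot \<open>s\<close> exist: they wake up in
      slot \<open>s - j0\<close>.\<close>
    from A have "t v < s" "0 < p (s - t v)" by (auto simp: attempt_prob_def split: if_splits)
    with j0(3)[of "s - t v"] have j0s: "j0 \<le> s" by force
    define c where "c = (\<lambda>i. Suc K + M * (s - j0) + i)"
    have lt: "M * (s - j0) + M \<le> M * m"
    proof -
      have "M * (s - j0) + M = M * Suc (s - j0)" by simp
      also have "\<dots> \<le> M * m" using True j0 j0s by (intro mult_le_mono2) linarith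
      finally show ?thesis .
    qed
    have c: "c i < n" "w s (c i) = p j0" if "i < M" for i
    proof -
      show "c i < n" using lt n that by (simp add: c_def)
      have "t (c i) = s - j0" using that lt by (simp add: t_def c_def)
      then show "w s (c i) = p j0" using True j0s lt that by (simp add: w_def c_def)
    qed
    have "\<beta> / 4 \<le> (\<Sum>i<M. w s (c i))" using M c(2) by simp
    also have "\<dots> = (\<Sum>v\<in>c ` {..<M}. w s v)" by (subst sum.reindex) (auto simp: c_def inj_on_def)
    also have "\<dots> \<le> (\<Sum>v<n. w s v)" using c(1) w_nonneg by (intro sum_mono2) auto
    finally show ?thesis by simp
  qed
  let ?q = "exp (1 - \<beta> / 8)"
  have q: "?q * (\<Sum>r<s. attempt_prob t r v) \<le> 1 / 160" if "s \<le> T" for s v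
  proof -
    have "?q * (\<Sum>r<s. attempt_prob t r v) \<le> ?q * mass p T"
      by (intro mult_left_mono order_trans[OF sum_attempt_prob_le mass_mono[OF that]]) simp
    with massT show ?thesis by linarith
  qed
  \<comment> \<open>In early slots the compensator vanishes, since a jammer of slot \<open>s\<close>
    cannot attempt earlier. Later the bound is \<open>1 / 160 * (2 / h) * (5 * \<beta>)\<close>,
    half of the \<open>\<beta> / (8 * h)\<close> that is subtracted.\<close>
  have compensator: "?q * (\<Sum>r<s. \<Sum>v<n. attempt_prob t r v * (exp (1 / h * w s v) - 1)) \<le> \<beta> / (16 * h)"
    if s: "s < T" for s
  proof (cases "s < m")
    case True
    have "attempt_prob t r v * (exp (1 / h * w s v) - 1) = 0" if "r < s" for r v
    proof (cases "w s v = 0")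
      case False
      then have "t v + j0 = s" using True by (simp add: w_def split: if_splits)
      then have "attempt_prob t r v = 0" using that j0(3)[of "r - t v"] by (auto simp: attempt_prob_def)
      then show ?thesis by simp
    qed simp
    then have "(\<Sum>r<s. \<Sum>v<n. attempt_prob t r v * (exp (1 / h * w s v) - 1)) = 0"
      by (intro sum.neutral ballI) auto
    then show ?thesis using \<beta> h by simp
  next
    case False
    have "?q * (\<Sum>r<s. \<Sum>v<n. attempt_prob t r v * (exp (1 / h * w s v) - 1))
        = (\<Sum>v<n. ?q * (\<Sum>r<s. attempt_prob t r v) * (exp (1 / h * w s v) - 1))"
      by (subst sum.swap) (simp add: sum_distrib_left sum_distrib_right mult.assoc)
    also have "\<dots> \<le> (\<Sum>v<n. 1 / 160 * (2 / h * w s v))"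
    proof (intro sum_mono mult_mono)
      fix v
      have "0 \<le> w s v" "w s v \<le> h" using False l h w_nonneg by (auto simp: w_def)
      then have x: "0 \<le> 1 / h * w s v" "1 / h * w s v \<le> 1" using h by auto
      show "exp (1 / h * w s v) - 1 \<le> 2 / h * w s v" using exp_le_one_plus_double[OF x] by simp
      show "0 \<le> exp (1 / h * w s v) - 1" using x by simp
      show "?q * (\<Sum>r<s. attempt_prob t r v) \<le> 1 / 160" using s by (intro q) simp
    qed simp
    also have "\<dots> = 1 / (80 * h) * (\<Sum>v<n. w s v)"
      unfolding sum_distrib_left by (intro sum.cong) auto
    also have "\<dots> \<le> 1 / (80 * h) * (5 * \<beta>)"
      using noise(2)[of s] False s h unfolding w_noise[OF False] by (intro mult_left_mono) auto
    finally show ?thesis by simp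
  qed
  have "pr n (\<lambda>x. 0 \<in> succeeded n t x T) \<le> ?q * (\<Sum>s<T. attempt_prob t s 0)
     + (\<Sum>s<T. exp (?q * (\<Sum>r<s. \<Sum>v<n. attempt_prob t r v * (exp (1 / h * w s v) - 1)) - 1 / h * (\<beta> / 8)))"
    using n h w_nonneg w_le contention by (intro prob_success_le) auto
  \<comment> \<open>The remaining exponent \<open>- \<beta> / (16 * h)\<close> is at most
    \<open>- 4 * ln (2 * (T + 1))\<close> by \<open>hT\<close>, so the terms of all \<open>T\<close>
    slots add up to less than 1/4.\<close>
  also have "\<dots> \<le> 1 / 160 + (\<Sum>s<T. 1 / (4 * (real T + 1)))"
  proof (intro add_mono q sum_mono)
    fix s assume "s \<in> {..<T}"
    then have "?q * (\<Sum>r<s. \<Sum>v<n. attempt_prob t r v * (exp (1 / h * w s v) - 1)) - 1 / h * (\<beta> / 8) \<le> \<beta> / (16 * h) - 1 / h * (\<beta> / 8)"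
      using compensator[of s] by (intro diff_right_mono) auto
    also have "\<dots> = - (4 * (\<beta> / 64 / h))" using h by (simp add: field_simps)
    also have "\<dots> \<le> - (4 * ln (2 * (real T + 1)))" using hT h by (simp add: field_simps)
    also have "\<dots> \<le> - (2 * ln (2 * (real T + 1)))" by simp
    also have "\<dots> = ln (1 / (2 * (real T + 1))\<^sup>2)" by (simp add: ln_div ln_realpow)
    finally have "exp (?q * (\<Sum>r<s. \<Sum>v<n. attempt_prob t r v * (exp (1 / h * w s v) - 1)) - 1 / h * (\<beta> / 8))
       \<le> exp (ln (1 / (2 * (real T + 1))\<^sup>2))" by (simp only: exp_le_cancel_iff)
    also have "\<dots> = 1 / (2 * (real T + 1))\<^sup>2" by (intro exp_ln divide_pos_pos zero_less_power) auto
    also have "\<dots> \<le> 1 / (4 * (real T + 1))"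
    proof (rule frac_le)
      show "4 * (real T + 1) \<le> (2 * (real T + 1))\<^sup>2" by (simp add: power2_eq_square algebra_simps)
    qed auto
    finally show "exp (?q * (\<Sum>r<s. \<Sum>v<n. attempt_prob t r v * (exp (1 / h * w s v) - 1)) - 1 / h * (\<beta> / 8)) \<le> 1 / (4 * (real T + 1))" .
  qed simp
  also have "\<dots> \<le> 1 / 2" by (simp add: field_simps)
  finally show ?thesis using n by (intro L_exp_ge[of 0 n t]) (auto simp: t_def)
qed

end

section \<open>Jamming\<close>

lemma succeededD: "v \<in> succeeded n t x s \<Longrightarrow> \<exists>r<s. attempting n t x r = {v}"
proof (induction s)
  case (Suc s)
  then show ?case by (auto simp: attempting_def less_Suc_eq)
qed simp

lemma latency_leD:
  assumes "latency n t x u \<le> enat T"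
  shows "\<exists>s. attempting n t x s = {u} \<and> s - t u \<le> T"
proof -
  let ?A = "{enat s |s. attempting n t x s = {u}}"
  have "?A \<noteq> {}"
  proof
    assume "?A = {}"
    then have "success_slot n t x u = \<infinity>" by (simp add: success_slot_def Inf_enat_def)
    with assms show False by (simp add: latency_def)
  qed
  then have "Inf ?A \<in> ?A" by (meson ex_in_conv wellorder_InfI)
  then obtain s where "success_slot n t x u = enat s" "attempting n t x s = {u}"
    by (auto simp: success_slot_def)
  then show ?thesis using assms by (auto simp: latency_def)
qed

context memoryless_protocol
begin

text \<open>The least \<open>L\<close> is attained, as \<infinity> always qualifies. An event
  disjoint from latency at most \<open>L_whp\<close> is therefore left with probability at most
  \<open>1 / n ^ 2\<close>.\<close>

lemma L_whp_witness:
  assumes n: "0 < n" and u: "u < n"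
    and E: "E \<in> sets (draws D n)" "\<And>x. x \<in> E \<Longrightarrow> \<not> latency n t x u \<le> L_whp D n"
  shows "measure (draws D n) E \<le> 1 / real n ^ 2"
proof -
  interpret P: prob_space "draws D n" by (rule prob_space_draws)
  let ?good = "\<lambda>L. \<forall>t. \<forall>u<n. measure (draws D n) {x \<in> space (draws D n). latency n t x u \<le> L} \<ge> 1 - 1 / real n ^ 2"
  have "?good \<infinity>" by (simp add: P.prob_space)
  then have "?good (L_whp D n)" unfolding L_whp_def L_quant_def by (rule LeastI)
  then have A: "1 - 1 / real n ^ 2 \<le> pr n (\<lambda>x. latency n t x u \<le> L_whp D n)" using u by blast
  let ?A = "{x \<in> space (draws D n). latency n t x u \<le> L_whp D n}"
  show ?thesis
  proof (cases "?A \<in> sets (draws D n)")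
    case True
    have "measure (draws D n) ?A + measure (draws D n) E = measure (draws D n) (?A \<union> E)"
      using E True by (intro P.finite_measure_Union[symmetric]) auto
    also have "\<dots> \<le> 1" by simp
    finally show ?thesis using A by simp
  next
    case False \<comment> \<open>then the event in the definition of \<^const>\<open>L_quant\<close> has the junk measure 0\<close>
    then have "pr n (\<lambda>x. latency n t x u \<le> L_whp D n) = 0" by (simp add: measure_notin_sets)
    with A have "1 \<le> 1 / real n ^ 2" by simp
    then show ?thesis using P.prob_le_1[of E] by linarith
  qed
qed

text \<open>The party with wake-up slot \<open>j0\<close> fails for \<open>T\<close> slots if it stays silent at the local times
  outside \<open>H\<close> and each local time in \<open>H\<close> is jammed by one of \<open>M\<close> parties that may attempt there
  for the first time.\<close>

lemma L_whp_jamming: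
  fixes H :: "nat set" and M T n j0 :: nat
  assumes j0: "1 \<le> j0" "\<And>i. 1 \<le> i \<Longrightarrow> i < j0 \<Longrightarrow> p i = 0"
    and H: "H \<subseteq> {1..T}" "\<And>i. i \<in> {1..T} - H \<Longrightarrow> p i \<le> 1 / 2" and n: "1 + M * card H \<le> n"
    and T: "L_whp D n \<le> enat T"
  shows "(1 - card H * (1 - p j0) ^ M) * exp (- 2 * (\<Sum>i\<in>{1..T} - H. p i)) \<le> 1 / real n ^ 2"
proof (cases "real (card H) * (1 - p j0) ^ M \<le> 1")
  case False
  then have "(1 - card H * (1 - p j0) ^ M) * exp (- 2 * (\<Sum>i\<in>{1..T} - H. p i)) \<le> 0"
    by (intro mult_nonpos_nonneg) auto
  also have "0 \<le> 1 / real n ^ 2" by simp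
  finally show ?thesis .
next
  case le1: True
  interpret P: prob_space "draws D n" by (rule prob_space_draws)
  have finH: "finite H" using H(1) finite_subset by blast
  obtain e where e: "bij_betw e {..<card H} H" using ex_bij_betw_nat_finite[OF finH] by (auto simp: atLeast0LessThan)
  \<comment> \<open>Local time \<open>i\<close> of party 0 is slot \<open>j0 + i\<close>, which is
    where a party woken up in slot \<open>i\<close> may first attempt. Waking party 0 in slot
    \<open>j0\<close> makes room for this even at \<open>i = 1\<close>.\<close>
  define t where "t = (\<lambda>v. if v = 0 then j0 else e ((v - 1) div M))"
  \<comment> \<open>Silence of party 0 outside \<open>H\<close>, and of all others before local time
    \<open>j0\<close>. The latter has probability 1 and excludes earlier successes of jammers
    pointwise.\<close>
  define Q where "Q = {0} \<times> ({1..T} - H) \<union> {1..<n} \<times> {1..<j0}"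
  \<comment> \<open>The first possible attempts of the jammers assigned to \<open>e k\<close>;
    silence on all of \<open>R k\<close> means that this slot is not jammed.\<close>
  define R where "R = (\<lambda>k. (\<lambda>i. (1 + M * k + i, j0)) ` {..<M})"
  define silent where "silent = (\<lambda>Q. {x \<in> space (draws D n). agrees Q (\<lambda>_. False) x})"
  have R_sub: "R k \<subseteq> {1..<n} \<times> {j0}" if "k < card H" for k
  proof -
    have "M * k + M = M * Suc k" by simp
    also have "\<dots> \<le> M * card H" using that by (intro mult_le_mono2) auto
    finally show ?thesis using n by (auto simp: R_def)
  qed
  have Q: "finite Q" "Q \<subseteq> {..<n} \<times> {1..}" using n by (auto simp: Q_def)
  have R: "finite (R k)" "R k \<subseteq> {..<n} \<times> {1..}" if "k < card H" for k
    using R_sub[OF that] j0(1) by (auto simp: R_def)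
  have sets: "silent S \<in> sets (draws D n)" if "finite S" "S \<subseteq> {..<n} \<times> {1..}" for S
    using pred_agrees[OF that] unfolding silent_def by measurable
  have silent: "measure (draws D n) (silent S) = (\<Prod>(v, i)\<in>S. 1 - p i)" if "finite S" "S \<subseteq> {..<n} \<times> {1..}" for S
    unfolding silent_def using cylinder[OF that, of "\<lambda>_. False"] by (simp add: bit_prob_def)
  define q where "q = measure (draws D n) (silent Q)"
  have silent_R: "measure (draws D n) (silent Q \<inter> silent (R k)) = q * (1 - p j0) ^ M" if k: "k < card H" for k
  proof -
    have "silent Q \<inter> silent (R k) = silent (Q \<union> R k)"
      by (auto simp: silent_def agrees_def)
    moreover have "Q \<inter> R k = {}" using R_sub[OF k] by (auto simp: Q_def)
    then have "measure (draws D n) (silent (Q \<union> R k)) = q * (\<Prod>(v, i)\<in>R k. 1 - p i)"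
      unfolding q_def using Q R[OF k] by (simp add: silent prod.union_disjoint)
    moreover have "(\<Prod>(v, i)\<in>R k. 1 - p i) = (1 - p j0) ^ M"
      unfolding R_def by (subst prod.reindex) (auto simp: inj_on_def)
    ultimately show ?thesis by simp
  qed
  let ?bad = "\<Union>k<card H. silent Q \<inter> silent (R k)"
  define E where "E = silent Q - ?bad"
  have bad_sets: "silent Q \<inter> silent (R k) \<in> sets (draws D n)" if "k < card H" for k
    using sets Q R[OF that] by auto
  have bad: "?bad \<in> sets (draws D n)" by (intro sets.finite_UN bad_sets) auto
  have "measure (draws D n) E = q - measure (draws D n) ?bad"
    unfolding E_def q_def by (rule P.finite_measure_Diff[OF sets[OF Q] bad]) auto
  moreover have "measure (draws D n) ?bad \<le> (\<Sum>k<card H. measure (draws D n) (silent Q \<inter> silent (R k)))"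
    using bad_sets by (intro P.finite_measure_subadditive_finite) auto
  moreover have "(\<Sum>k<card H. measure (draws D n) (silent Q \<inter> silent (R k))) = card H * (q * (1 - p j0) ^ M)"
    using silent_R by simp
  ultimately have E: "q * (1 - card H * (1 - p j0) ^ M) \<le> measure (draws D n) E"
    by (simp add: algebra_simps)
  have E_sets: "E \<in> sets (draws D n)"
    unfolding E_def using bad sets[OF Q] by (rule sets.Diff[rotated])
  have fails: "\<not> latency n t x 0 \<le> L_whp D n" if x: "x \<in> E" for x
  proof
    assume "latency n t x 0 \<le> L_whp D n"
    from latency_leD[OF order_trans[OF this T]] obtain s
      where s: "attempting n t x s = {0}" "s - j0 \<le> T" by (auto simp: t_def)
    have "t 0 = j0" by (simp add: t_def)
    moreover have "0 \<in> attempting n t x s" using s(1) by simp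
    ultimately have att: "j0 < s" "x 0 (s - j0)"
      by (simp_all add: attempting_def attempting_given_def)
    have silentQ: "\<not> x v i" if "(v, i) \<in> Q" for v i
      using x that by (auto simp: E_def silent_def agrees_def)
    have "s - j0 \<in> H"
    proof (rule ccontr)
      assume "s - j0 \<notin> H"
      then have "(0, s - j0) \<in> Q" using att(1) s(2) by (auto simp: Q_def)
      with silentQ att(2) show False by blast
    qed
    then have "s - j0 \<in> e ` {..<card H}" using bij_betw_imp_surj_on[OF e] by simp
    then obtain k where k: "k < card H" "e k = s - j0" by auto
    have "x \<notin> silent (R k)" "x \<in> space (draws D n)" using x k(1) by (auto simp: E_def silent_def)
    then obtain v where v: "(v, j0) \<in> R k" "x v j0" by (auto simp: silent_def agrees_def R_def)
    then have vn: "v < n" "v \<noteq> 0" using R_sub[OF k(1)] by auto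
    have tv: "t v = s - j0" using v(1) k by (auto simp: t_def R_def)
    \<comment> \<open>A success before slot \<open>s\<close> would use a local time below
      \<open>j0\<close>, where \<open>Q\<close> forces silence. So \<open>v\<close> still attempts
      and collides with party 0.\<close>
    have "v \<notin> succeeded n t x s"
    proof
      assume "v \<in> succeeded n t x s"
      from succeededD[OF this] obtain r where r: "r < s" "attempting n t x r = {v}" by auto
      then have "v \<in> attempting n t x r" by simp
      then have "s - j0 < r" "x v (r - (s - j0))"
        using tv by (simp_all add: attempting_def attempting_given_def)
      moreover from this r(1) att(1) have "(v, r - (s - j0)) \<in> Q" using vn by (auto simp: Q_def)
      ultimately show False using silentQ by blast
    qed
    then have "v \<in> attempting n t x s"
      using att(1) v(2) tv vn j0(1) by (simp add: attempting_def attempting_given_def)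
    with s(1) vn show False by simp
  qed
  have "exp (- 2 * (\<Sum>i\<in>{1..T} - H. p i)) = (\<Prod>i\<in>{1..T} - H. exp (- (2 * p i)))"
    by (simp add: exp_sum[symmetric] sum_distrib_left sum_negf)
  also have "\<dots> \<le> (\<Prod>i\<in>{1..T} - H. 1 - p i)"
    using H(2) exp_minus_le_one_minus_half[of "2 * p _"] p_nonneg by (intro prod_mono) fastforce
  also have "\<dots> = q"
  proof -
    have "q = (\<Prod>(v, i)\<in>{0::nat} \<times> ({1..T} - H). 1 - p i)"
      unfolding q_def silent[OF Q] using j0 Q(1)
      by (intro prod.mono_neutral_right) (auto simp: Q_def)
    also have "\<dots> = (\<Prod>i\<in>{1..T} - H. 1 - p i)"
      by (rule prod.reindex_bij_witness[where i="\<lambda>i. (0, i)" and j=snd]) auto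
    finally show ?thesis ..
  qed
  finally have "(1 - card H * (1 - p j0) ^ M) * exp (- 2 * (\<Sum>i\<in>{1..T} - H. p i)) \<le> (1 - card H * (1 - p j0) ^ M) * q"
    using le1 by (intro mult_left_mono) auto
  also have "\<dots> \<le> measure (draws D n) E" using E by (simp add: mult.commute)
  also have "\<dots> \<le> 1 / real n ^ 2" using n by (intro L_whp_witness[OF _ _ E_sets fails]) auto
  finally show ?thesis .
qed

text \<open>If all bits were almost surely 0, nobody would ever succeed;
  \<open>L_whp_jamming\<close> without jammers then gives \<open>1 \<le> 1 / n ^ 2\<close>.\<close>

lemma ex_first_attempt:
  assumes "2 \<le> n" "L_whp D n \<noteq> \<infinity>"
  obtains j0 where "1 \<le> j0" "0 < p j0" "\<And>i. 1 \<le> i \<Longrightarrow> i < j0 \<Longrightarrow> p i = 0"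
proof -
  have "\<exists>i\<ge>1. 0 < p i"
  proof (rule ccontr)
    assume "\<not> ?thesis"
    then have zero: "p i = 0" if "1 \<le> i" for i using p_nonneg[of i] that by force
    obtain T where T: "L_whp D n = enat T" using assms(2) by auto
    have "1 \<le> 1 / real n ^ 2"
      using L_whp_jamming[of 1 "{}" T 0 n] zero assms(1) by (simp add: T)
    moreover have "1 < real n ^ 2" using assms(1) by (simp add: one_less_power)
    ultimately show False using assms(1) by (simp add: field_simps)
  qed
  then obtain i where i: "1 \<le> i \<and> 0 < p i" by auto
  define j0 where "j0 = (LEAST i. 1 \<le> i \<and> 0 < p i)"
  have "1 \<le> j0 \<and> 0 < p j0" unfolding j0_def by (rule LeastI[of "\<lambda>i. 1 \<le> i \<and> 0 < p i", OF i])
  moreover have "p i = 0" if "1 \<le> i" "i < j0" for i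
    using not_less_Least[of i "\<lambda>i. 1 \<le> i \<and> 0 < p i"] that p_nonneg[of i] by (fastforce simp: j0_def)
  ultimately show ?thesis using that by blast
qed

end

section \<open>Asymptotics\<close>

context memoryless_protocol
begin

lemma light_part_nonneg: "0 \<le> light_part h p i"
  using p_nonneg by (simp add: light_part_def)

lemma mass_le: "mass p m \<le> real m"
  unfolding mass_def using sum_bounded_above[of "{1..m}" p 1] p_le_1 by simp

lemma mass_light_le: "mass (light_part h p) m \<le> mass p m"
  unfolding mass_def using p_nonneg by (intro sum_mono) (auto simp: light_part_def)

text \<open>The noise bound for \<open>n = m ^ 4\<close>: half of the parties make the noise, and
  jamming the first \<open>m\<close> slots fits into the other half. The fourth power changes
  logarithms only by a constant factor.\<close>

lemma L_exp_ge_scaled: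
  fixes \<beta> h :: real and m j0 :: nat
  assumes j0: "1 \<le> j0" "0 < p j0" "\<forall>i\<in>{1..<j0}. p i = 0"
    and h: "0 < h" and \<beta>: "1 \<le> \<beta>" "2 * \<beta> \<le> mass (light_part h p) m"
    and m: "2 \<le> m" "1 + real m * (\<beta> / (4 * p j0) + 1) \<le> real m ^ 4 / 2"
    and massT: "exp (1 - \<beta> / 8) * mass p (m ^ 5) \<le> 1 / 160"
    and hT: "h * ln (2 * (real m ^ 5 + 1)) \<le> \<beta> / 64"
  shows "ennreal (real m ^ 4 * mass (light_part h p) m / (16 * \<beta>)) \<le> L_exp D (m ^ 4)"
proof -
  let ?S = "mass (light_part h p) m"
  define K where "K = m ^ 4 div 2"
  define M where "M = nat \<lceil>\<beta> / (4 * p j0)\<rceil>"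
  define T where "T = K * nat \<lfloor>?S / \<beta>\<rfloor>"
  have "real M = of_int \<lceil>\<beta> / (4 * p j0)\<rceil>" unfolding M_def using \<beta> j0 by simp
  then have M: "\<beta> / (4 * p j0) \<le> real M" "real M \<le> \<beta> / (4 * p j0) + 1" by linarith+
  have "1 + real m * real M \<le> 1 + real m * (\<beta> / (4 * p j0) + 1)" using M(2) by (intro add_left_mono mult_left_mono) auto
  also note m(2)
  finally have "2 * (1 + real m * real M) \<le> real m ^ 4" by simp
  then have "real (2 * (1 + M * m)) \<le> real (m ^ 4)" by (simp add: algebra_simps)
  then have "2 * (1 + M * m) \<le> m ^ 4" by (simp only: of_nat_le_iff)
  moreover have "1 + a div 2 + b \<le> a" if "2 * (1 + b) \<le> a" for a b :: nat using that by presburger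
  ultimately have parties: "1 + K + M * m \<le> m ^ 4" unfolding K_def by blast
  have S2: "2 \<le> ?S / \<beta>" using \<beta> by (simp add: field_simps)
  have floor: "real (nat \<lfloor>?S / \<beta>\<rfloor>) = of_int \<lfloor>?S / \<beta>\<rfloor>" using S2 by simp
  have "?S / (2 * \<beta>) = ?S / \<beta> / 2" by simp
  also have "\<dots> \<le> real (nat \<lfloor>?S / \<beta>\<rfloor>)"
  proof -
    have "x / 2 \<le> of_int \<lfloor>x\<rfloor>" if "2 \<le> x" for x :: real using that by linarith
    from this[OF S2] show ?thesis unfolding floor .
  qed
  finally have floor_ge: "?S / (2 * \<beta>) \<le> real (nat \<lfloor>?S / \<beta>\<rfloor>)" .
  have "(2::nat) ^ 4 \<le> m ^ 4" using m(1) by (rule power_mono) simp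
  then have "16 \<le> m ^ 4" by simp
  then have "real (m ^ 4) / 4 \<le> real K" unfolding K_def by linarith
  then have K: "real m ^ 4 / 4 \<le> real K" by simp
  have "real m ^ 4 * ?S / (8 * \<beta>) = real m ^ 4 / 4 * (?S / (2 * \<beta>))" by simp
  also have "\<dots> \<le> real K * real (nat \<lfloor>?S / \<beta>\<rfloor>)"
    using K floor_ge \<beta> by (intro mult_mono) auto
  finally have T_ge: "real m ^ 4 * ?S / (8 * \<beta>) \<le> real T" by (simp add: T_def)
  have "?S / \<beta> \<le> ?S" using \<beta> by (simp add: divide_le_eq mult_left_le)
  also have "?S \<le> real m" using mass_light_le mass_le by (rule order_trans)
  finally have "nat \<lfloor>?S / \<beta>\<rfloor> \<le> m" by linarith
  moreover have "K \<le> m ^ 4" by (simp add: K_def)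
  ultimately have "T \<le> m ^ 4 * m" unfolding T_def by (rule mult_le_mono[rotated])
  then have T_le: "T \<le> m ^ 5" by (simp add: eval_nat_numeral mult_ac)
  have "ennreal (real T / 2) \<le> L_exp D (m ^ 4)"
    unfolding T_def
  proof (rule L_exp_ge_of_noise[OF j0(1,2) _ h _ _ _ parties])
    show "\<beta> / 4 \<le> real M * p j0" using M(1) j0(2) by (simp add: field_simps)
    have "exp (1 - \<beta> / 8) * mass p T \<le> exp (1 - \<beta> / 8) * mass p (m ^ 5)"
      using mass_mono[OF T_le] by (intro mult_left_mono) auto
    then show "exp (1 - \<beta> / 8) * mass p (K * nat \<lfloor>?S / \<beta>\<rfloor>) \<le> 1 / 160" using massT unfolding T_def by (rule order_trans)
    have "ln (2 * (x + 1)) \<le> ln (2 * (y + 1))" if "0 \<le> x" "x \<le> y" for x y :: real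
      using that by simp
    moreover have "real T \<le> real m ^ 5" using T_le by (metis of_nat_le_iff of_nat_power)
    ultimately have "ln (2 * (real T + 1)) \<le> ln (2 * (real m ^ 5 + 1))" by (meson of_nat_0_le_iff)
    then have "h * ln (2 * (real T + 1)) \<le> h * ln (2 * (real m ^ 5 + 1))"
      using h by (intro mult_left_mono) auto
    then show "h * ln (2 * (real (K * nat \<lfloor>?S / \<beta>\<rfloor>) + 1)) \<le> \<beta> / 64" using hT by (simp add: T_def)
  qed (use \<beta> j0(3) in auto)
  moreover have "ennreal (real m ^ 4 * ?S / (16 * \<beta>)) \<le> ennreal (real T / 2)"
  proof (rule ennreal_leI)
    have "real m ^ 4 * ?S / (16 * \<beta>) = real m ^ 4 * ?S / (8 * \<beta>) / 2" by simp
    also have "\<dots> \<le> real T / 2" using T_ge by (rule divide_right_mono) simp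
    finally show "real m ^ 4 * ?S / (16 * \<beta>) \<le> real T / 2" .
  qed
  ultimately show ?thesis by order
qed

section \<open>Upper bounds on the light mass from the expected latency\<close>

abbreviation rate :: "nat \<Rightarrow> real" where
  "rate n \<equiv> real n * (ln (real n))^2 / (ln (ln (real n)))^2"

text \<open>\<open>h\<close> and \<open>\<beta>\<close> are quantified inside the eventuality so
  that they may depend on \<open>m\<close>. If the mass is at least \<open>2 * \<beta>\<close>,
  comparing latencies yields 256 as the product of the 16 of the noise bound and the 16 in
  \<open>(4 * ln m)^2\<close>.\<close>

lemma light_mass_le:
  assumes exp: "L_exp_smallo D rate"
    and j0: "1 \<le> j0" "0 < p j0" "\<forall>i\<in>{1..<j0}. p i = 0" and \<epsilon>: "0 < \<epsilon>"
  shows "\<forall>\<^sub>F m in sequentially. \<forall>h \<beta>. 0 < h \<longrightarrow> 1 \<le> \<beta> \<longrightarrow>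
    1 + real m * (\<beta> / (4 * p j0) + 1) \<le> real m ^ 4 / 2 \<longrightarrow>
    exp (1 - \<beta> / 8) * mass p (m ^ 5) \<le> 1 / 160 \<longrightarrow>
    h * ln (2 * (real m ^ 5 + 1)) \<le> \<beta> / 64 \<longrightarrow>
    mass (light_part h p) m \<le> 2 * \<beta> + 256 * \<epsilon> * \<beta> * (ln m)^2 / (ln (ln m))^2"
proof -
  have "\<forall>\<^sub>F n in sequentially. L_exp D n \<le> ennreal (\<epsilon> * rate n)"
  proof -
    have "(\<lambda>n. enn2real (L_exp D n)) \<in> o(rate)" and fin: "\<forall>\<^sub>F n in sequentially. L_exp D n \<noteq> \<infinity>"
      using exp by (auto simp: L_exp_smallo_def)
    from landau_o.smallD[OF this(1) \<epsilon>] fin show ?thesis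
    proof eventually_elim
      case (elim n)
      have "L_exp D n = ennreal (enn2real (L_exp D n))" using elim(2) by (simp add: ennreal_enn2real_if)
      also have "\<dots> \<le> ennreal (\<epsilon> * rate n)" using elim(1) by (intro ennreal_leI) simp
      finally show ?case .
    qed
  qed
  then have "\<forall>\<^sub>F m in sequentially. L_exp D (m ^ 4) \<le> ennreal (\<epsilon> * rate (m ^ 4))"
    by (rule eventually_compose_filterlim) real_asymp
  moreover have "\<forall>\<^sub>F m::nat in sequentially. 2 \<le> m \<and> 0 < ln (ln (real m)) \<and> 0 < ln (real m)"
    by (intro eventually_conj) real_asymp+
  ultimately show ?thesis
  proof eventually_elim
    case (elim m)
    show ?case
    proof (intro allI impI)
      fix h \<beta> :: real
      let ?S = "mass (light_part h p) m"
      assume h: "0 < h" and \<beta>: "1 \<le> \<beta>" and *: "1 + real m * (\<beta> / (4 * p j0) + 1) \<le> real m ^ 4 / 2"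
        "exp (1 - \<beta> / 8) * mass p (m ^ 5) \<le> 1 / 160" "h * ln (2 * (real m ^ 5 + 1)) \<le> \<beta> / 64"
      have L: "0 < ln (ln (real m))" "0 < ln (real m)" using elim by auto
      have nonneg: "0 \<le> 256 * \<epsilon> * \<beta> * (ln m)^2 / (ln (ln m))^2" using \<epsilon> \<beta> by simp
      show "?S \<le> 2 * \<beta> + 256 * \<epsilon> * \<beta> * (ln m)^2 / (ln (ln m))^2"
      proof (cases "2 * \<beta> \<le> ?S")
        case True
        have "ennreal (real m ^ 4 * ?S / (16 * \<beta>)) \<le> ennreal (\<epsilon> * rate (m ^ 4))"
          using L_exp_ge_scaled[OF j0 h \<beta> True _ *] elim by (auto intro: order_trans)
        then have "real m ^ 4 * ?S / (16 * \<beta>) \<le> \<epsilon> * rate (m ^ 4)"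
          using \<epsilon> by (subst (asm) ennreal_le_iff) auto
        also have "rate (m ^ 4) = real m ^ 4 * ((4 * ln m)^2 / (ln (4 * ln m))^2)"
          using elim by (simp add: ln_realpow)
        also have "\<epsilon> * \<dots> \<le> \<epsilon> * (real m ^ 4 * ((4 * ln m)^2 / (ln (ln m))^2))"
          using \<epsilon> L by (intro mult_left_mono divide_left_mono power_mono) auto
        finally have "real m ^ 4 * ?S \<le> real m ^ 4 * (256 * \<epsilon> * \<beta> * (ln m)^2 / (ln (ln m))^2)"
          using \<beta> by (simp add: field_simps)
        then have "?S \<le> 256 * \<epsilon> * \<beta> * (ln m)^2 / (ln (ln m))^2"
          using elim by (subst (asm) mult_le_cancel_left_pos) auto
        with \<beta> show ?thesis by linarith
      qed (use nonneg in linarith)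
    qed
  qed
qed

text \<open>A first pass with \<open>h = 1\<close>, where every attempt is light, and
  \<open>\<beta> = 400 * ln m\<close>: then \<open>exp (- \<beta> / 8)\<close> beats even the
  trivial bound \<open>m ^ 5\<close> on the mass.\<close>

lemma mass_le_polylog:
  assumes exp: "L_exp_smallo D rate"
    and j0: "1 \<le> j0" "0 < p j0" "\<forall>i\<in>{1..<j0}. p i = 0"
  shows "\<forall>\<^sub>F m in sequentially. mass p m \<le> (ln (real m)) ^ 4"
proof -
  define c where "c = 100 / p j0"
  have c: "0 < c" using j0 by (simp add: c_def)
  have "\<forall>\<^sub>F m::nat in sequentially. 1 \<le> 400 * ln (real m)" by real_asymp
  moreover have "\<forall>\<^sub>F m::nat in sequentially. 1 + real m * (c * ln (real m) + 1) \<le> real m ^ 4 / 2"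
    using c by real_asymp
  moreover have "\<forall>\<^sub>F m::nat in sequentially. exp (1 - 50 * ln (real m)) * real m ^ 5 \<le> 1 / 160" by real_asymp
  moreover have "\<forall>\<^sub>F m::nat in sequentially. 1 * ln (2 * (real m ^ 5 + 1)) \<le> 400 * ln (real m) / 64" by real_asymp
  moreover have "\<forall>\<^sub>F m::nat in sequentially. 2 * (400 * ln (real m)) + 256 * 1 * (400 * ln (real m)) * (ln (real m))^2 / (ln (ln (real m)))^2 \<le> (ln (real m)) ^ 4"
    by real_asymp
  ultimately show ?thesis using light_mass_le[OF exp j0 zero_less_one]
  proof eventually_elim
    case (elim m)
    have "light_part 1 p = p" using p_le_1 by (auto simp: light_part_def)
    have "exp (1 - 400 * ln (real m) / 8) * mass p (m ^ 5) \<le> exp (1 - 50 * ln (real m)) * real m ^ 5"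
      using mult_left_mono[OF mass_le[of "m ^ 5"], of "exp (1 - 50 * ln (real m))"] by simp
    from order_trans[OF this elim(3)]
    have massT: "exp (1 - 400 * ln (real m) / 8) * mass p (m ^ 5) \<le> 1 / 160" .
    have "c * ln (real m) = 400 * ln (real m) / (4 * p j0)" by (simp add: c_def)
    with elim(2) have parties: "1 + real m * (400 * ln (real m) / (4 * p j0) + 1) \<le> real m ^ 4 / 2" by simp
    from order_trans[OF elim(6)[rule_format, OF zero_less_one elim(1) parties massT elim(4)] elim(5)]
    show ?case by (simp only: \<open>light_part 1 p = p\<close>)
  qed
qed

section \<open>Lower bounds on the light mass from the latency with high probability\<close>

lemma L_whp_polylog:
  assumes "L_whp_bigo D (\<lambda>n. real n * (ln (real n)) ^ k)"
  shows "\<forall>\<^sub>F n in sequentially. \<exists>T. L_whp D n = enat T \<and> real T \<le> real n * (ln (real n)) ^ (k + 2)"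
proof -
  have fin: "\<forall>\<^sub>F n in sequentially. L_whp D n \<noteq> \<infinity>"
    and "(\<lambda>n. real (the_enat (L_whp D n))) \<in> O(\<lambda>n. real n * (ln (real n)) ^ k)"
    using assms by (auto simp: L_whp_bigo_def)
  then obtain c where c: "0 < c"
    and bound: "\<forall>\<^sub>F n in sequentially. norm (real (the_enat (L_whp D n))) \<le> c * norm (real n * (ln (real n)) ^ k)"
    by (elim landau_o.bigE)
  have "\<forall>\<^sub>F n::nat in sequentially. c \<le> (ln (real n))^2 \<and> 0 \<le> ln (real n)"
    using c by (intro eventually_conj) real_asymp+
  with fin bound show ?thesis
  proof eventually_elim
    case (elim n)
    then obtain T where T: "L_whp D n = enat T" by auto
    have "real T \<le> c * (real n * (ln (real n)) ^ k)" using elim T by simp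
    \<comment> \<open>Spending two logarithms on the constant also makes the exponent at least 2, as
      the geometric scales require later.\<close>
    also have "\<dots> \<le> (ln (real n))^2 * (real n * (ln (real n)) ^ k)" using elim by (intro mult_right_mono) auto
    also have "\<dots> = real n * (ln (real n)) ^ (k + 2)" by (simp add: power_add mult_ac power2_eq_square)
    finally show ?case using T by auto
  qed
qed

text \<open>\<open>L_whp_jamming\<close> with \<open>H\<close> made of the local times up to
  \<open>a\<close> and the heavy ones. Polylogarithmic total mass leaves few heavy times, so a
  logarithmic number of jammers for each element of \<open>H\<close> is affordable, and the bound on
  the failure probability forces the remaining light mass up.\<close>

lemma light_mass_scale_ge:
  assumes exp: "L_exp_smallo D rate"
    and whp: "\<forall>\<^sub>F n in sequentially. \<exists>T. L_whp D n = enat T \<and> real T \<le> real n * (ln (real n)) ^ \<kappa>"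
    and j0: "1 \<le> j0" "0 < p j0" "\<forall>i\<in>{1..<j0}. p i = 0"
  shows "\<forall>\<^sub>F n::nat in sequentially. \<forall>a b. real a * (ln (real n))^2 \<le> real n \<longrightarrow>
    real n * (ln (real n)) ^ \<kappa> \<le> real b \<longrightarrow>
    ln (real n) / 2 \<le> (\<Sum>i\<in>{a<..b}. light_part (1 / ln (real n)) p i)"
proof -
  \<comment> \<open>With \<open>c * ln n\<close> jammers a slot stays unjammed with probability at
    most \<open>exp (- c * ln n * p j0) = 1 / n ^ 2\<close>.\<close>
  define c where "c = 2 / p j0"
  have c: "0 < c" using j0 by (simp add: c_def)
  have "\<forall>\<^sub>F n in sequentially. mass p (n ^ 2) \<le> (ln (real (n ^ 2))) ^ 4"
    using mass_le_polylog[OF exp j0] by (rule eventually_compose_filterlim) real_asymp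
  moreover have "\<forall>\<^sub>F n::nat in sequentially. 2 \<le> ln (real n)" by real_asymp
  moreover have "\<forall>\<^sub>F n::nat in sequentially. real n * (ln (real n)) ^ \<kappa> \<le> real n ^ 2" by real_asymp
  moreover have "\<forall>\<^sub>F n::nat in sequentially.
      1 + (c * ln (real n) + 1) * (real n / (ln (real n))^2 + (2 * ln (real n)) ^ 4 * ln (real n)) \<le> real n"
    using c by real_asymp
  ultimately show ?thesis using whp
  proof eventually_elim
    case (elim n)
    obtain T where T: "L_whp D n = enat T" "real T \<le> real n * (ln (real n)) ^ \<kappa>" using elim(5) by auto
    define L where "L = ln (real n)"
    have L: "2 \<le> L" using elim(2) by (simp add: L_def)
    have n0: "0 < n" using elim(2) by (cases n) auto
    show ?case
    proof (intro allI impI)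
      fix a b assume a: "real a * (ln (real n))^2 \<le> real n" and b: "real n * (ln (real n)) ^ \<kappa> \<le> real b"
      have "real T \<le> real (n ^ 2)" using order_trans[OF T(2) elim(3)] unfolding of_nat_power .
      then have Tn: "T \<le> n ^ 2" by (simp only: of_nat_le_iff)
      have Tb: "T \<le> b" using T(2) b by linarith
      define heavy where "heavy = {i \<in> {1..T}. 1 / L < p i}"
      define H where "H = {1..T} \<inter> {..a} \<union> heavy"
      have "real (card heavy) * (1 / L) = (\<Sum>i\<in>heavy. 1 / L)" by simp
      also have "\<dots> \<le> (\<Sum>i\<in>heavy. p i)" by (intro sum_mono) (auto simp: heavy_def)
      also have "\<dots> \<le> mass p T" unfolding mass_def using p_nonneg by (intro sum_mono2) (auto simp: heavy_def)
      also have "\<dots> \<le> mass p (n ^ 2)" by (rule mass_mono[OF Tn])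
      also have "\<dots> \<le> (2 * L) ^ 4" using elim(1) n0 by (simp add: L_def ln_realpow)
      finally have heavy: "real (card heavy) \<le> (2 * L) ^ 4 * L" using L by (simp add: field_simps)
      have "card ({1..T} \<inter> {..a}) \<le> card {1..a}" by (intro card_mono) auto
      then have "card H \<le> a + card heavy" unfolding H_def using card_Un_le[of "{1..T} \<inter> {..a}" heavy] by simp
      then have "real (card H) \<le> real a + real (card heavy)" by linarith
      moreover have "real a \<le> real n / L^2" using a L by (simp add: L_def field_simps)
      ultimately have H: "real (card H) \<le> real n / L^2 + (2 * L) ^ 4 * L" using heavy by linarith
      define M where "M = nat \<lceil>c * L\<rceil>"
      have "0 < c * L" using c L by simp
      then have M: "c * L \<le> real M" "real M \<le> c * L + 1" "1 \<le> M" unfolding M_def by linarith+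
      have "1 + real M * real (card H) \<le> 1 + (c * L + 1) * (real n / L^2 + (2 * L) ^ 4 * L)"
        using M H \<open>0 < c * L\<close> by (intro add_left_mono mult_mono) auto
      also have "\<dots> \<le> real n" using elim(4) by (simp add: L_def)
      finally have "real (1 + M * card H) \<le> real n" by simp
      then have parties: "1 + M * card H \<le> n" by (simp only: of_nat_le_iff)
      have silent: "(1 - p j0) ^ M \<le> 1 / real n ^ 2"
      proof -
        have "(1 - p j0) ^ M \<le> exp (- p j0) ^ M"
          using p_le_1[of j0] exp_ge_add_one_self[of "- p j0"] by (intro power_mono) auto
        also have "\<dots> = exp (- (real M * p j0))" by (simp add: exp_of_nat_mult[symmetric])
        also have "\<dots> \<le> exp (- (2 * L))"
        proof -
          have "2 * L = c * L * p j0" using j0 by (simp add: c_def)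
          also have "\<dots> \<le> real M * p j0" using M(1) j0 by (intro mult_right_mono) auto
          finally show ?thesis by simp
        qed
        also have "\<dots> = 1 / real n ^ 2" using n0 by (simp add: L_def exp_minus exp_double inverse_eq_divide)
        finally show ?thesis .
      qed
      have n2: "2 \<le> real n"
      proof -
        have "ln (real n) \<le> real n - 1" using n0 by (intro ln_le_minus_one) simp
        with L show ?thesis by (simp add: L_def)
      qed
      have half: "1 / 2 \<le> 1 - card H * (1 - p j0) ^ M"
      proof -
        have "card H \<le> M * card H" using M(3) by simp
        with parties have "real (card H) \<le> real n" by linarith
        then have "card H * (1 - p j0) ^ M \<le> real n * (1 / real n ^ 2)"
          using silent p_le_1[of j0] by (intro mult_mono) auto
        also have "\<dots> = 1 / real n" by (simp add: power2_eq_square)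
        also have "\<dots> \<le> 1 / 2" using n2 by (intro divide_left_mono) auto
        finally show ?thesis by simp
      qed
      let ?m = "\<Sum>i\<in>{1..T} - H. p i"
      have L_half: "1 / L \<le> 1 / 2" using L by (intro divide_left_mono) auto
      have "p i \<le> 1 / 2" if "i \<in> {1..T} - H" for i
      proof -
        have "p i \<le> 1 / L" using that by (auto simp: H_def heavy_def)
        with L_half show ?thesis by linarith
      qed
      then have "(1 - card H * (1 - p j0) ^ M) * exp (- 2 * ?m) \<le> 1 / real n ^ 2"
        using j0 T parties by (intro L_whp_jamming) (auto simp: H_def heavy_def)
      moreover have "1 / 2 * exp (- 2 * ?m) \<le> (1 - card H * (1 - p j0) ^ M) * exp (- 2 * ?m)"
        using half by (intro mult_right_mono) auto
      ultimately have "exp (- 2 * ?m) \<le> 2 / real n ^ 2" by linarith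
      \<comment> \<open>The factor 2 is traded for a whole factor \<open>n\<close>, which is why the
        result is \<open>L / 2\<close> rather than nearly \<open>L\<close>.\<close>
      also have "\<dots> \<le> real n / real n ^ 2" using n2 by (intro divide_right_mono) auto
      also have "\<dots> = exp (- L)" using n0 by (simp add: L_def exp_minus power2_eq_square inverse_eq_divide)
      finally have "L / 2 \<le> ?m" by simp
      also have "?m = (\<Sum>i\<in>{1..T} - H. light_part (1 / L) p i)"
        by (intro sum.cong) (auto simp: H_def heavy_def light_part_def)
      also have "\<dots> \<le> (\<Sum>i\<in>{a<..b}. light_part (1 / L) p i)"
        using Tb light_part_nonneg by (intro sum_mono2) (auto simp: H_def)
      finally show "ln (real n) / 2 \<le> (\<Sum>i\<in>{a<..b}. light_part (1 / ln (real n)) p i)"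
        by (simp add: L_def)
    qed
  qed
qed

text \<open>Disjoint windows from \<open>a\<close> to \<open>a * \<rho> ^ 2\<close>, each served by
  the scale \<open>n = a * \<rho>\<close> in its middle: one factor \<open>\<rho>\<close> covers
  \<open>(ln n)^2\<close>, the other \<open>(ln n) ^ \<kappa>\<close>. As \<open>m = A ^ 2\<close>,
  all scales have \<open>ln n \<ge> ln m / 2\<close>, so the single threshold
  \<open>2 / ln m\<close> suits them all.\<close>

lemma light_mass_geometric:
  fixes A \<rho> \<kappa> m :: nat
  assumes scale: "\<And>n. A \<le> n \<Longrightarrow> \<forall>a b. real a * (ln (real n))^2 \<le> real n \<longrightarrow>
      real n * (ln (real n)) ^ \<kappa> \<le> real b \<longrightarrow>
      ln (real n) / 2 \<le> (\<Sum>i\<in>{a<..b}. light_part (1 / ln (real n)) p i)"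
    and A: "1 < A" and \<kappa>: "2 \<le> \<kappa>" and m: "m = A ^ 2" "1 \<le> ln (real m)" and \<rho>: "ln (real m) ^ \<kappa> \<le> real \<rho>"
    and le: "A * \<rho> ^ (2 * r) \<le> m"
  shows "real r * (ln (real A) / 2) \<le> mass (light_part (2 / ln (real m)) p) (A * \<rho> ^ (2 * r))"
  using le
proof (induction r)
  case 0
  then show ?case unfolding mass_def using light_part_nonneg by (simp add: sum_nonneg)
next
  case (Suc r)
  define a where "a = A * \<rho> ^ (2 * r)"
  define n where "n = a * \<rho>"
  define b where "b = n * \<rho>"
  have b: "b = A * \<rho> ^ (2 * Suc r)" by (simp add: b_def n_def a_def mult_ac)
  have "1 \<le> ln (real m) ^ \<kappa>" using m by simp
  then have \<rho>1: "1 \<le> \<rho>" using \<rho> by linarith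
  have "A \<le> a" using \<rho>1 by (simp add: a_def)
  moreover have "a \<le> n" "n \<le> b" using \<rho>1 by (simp_all add: n_def b_def)
  moreover have "b \<le> m" using Suc.prems b by simp
  ultimately have bounds: "A \<le> n" "a \<le> m" "n \<le> m" by linarith+
  have lnA: "0 < ln (real A)" "ln (real A) \<le> ln (real n)" "ln (real n) \<le> ln (real m)"
    using A bounds by simp_all
  have lnm: "ln (real m) = 2 * ln (real A)" using A by (simp add: m ln_realpow)
  have pow: "ln (real n) ^ e \<le> real \<rho>" if "e \<le> \<kappa>" for e
  proof -
    have "ln (real n) ^ e \<le> ln (real m) ^ e" using lnA by (intro power_mono) auto
    also have "\<dots> \<le> ln (real m) ^ \<kappa>" using m(2) that by (intro power_increasing) auto
    finally show ?thesis using \<rho> by linarith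
  qed
  have "real a * (ln (real n))^2 \<le> real n"
    using mult_left_mono[OF pow[OF \<kappa>], of "real a"] by (simp add: n_def)
  moreover have "real n * (ln (real n)) ^ \<kappa> \<le> real b"
    using mult_left_mono[OF pow[OF order_refl], of "real n"] by (simp add: b_def)
  ultimately have "ln (real n) / 2 \<le> (\<Sum>i\<in>{a<..b}. light_part (1 / ln (real n)) p i)"
    using scale[OF bounds(1)] by blast
  also have "\<dots> \<le> (\<Sum>i\<in>{a<..b}. light_part (2 / ln (real m)) p i)"
  proof (rule sum_mono)
    fix i
    have "1 / ln (real n) \<le> 1 / ln (real A)" using lnA by (intro divide_left_mono) auto
    also have "\<dots> = 2 / ln (real m)" by (simp add: lnm)
    finally show "light_part (1 / ln (real n)) p i \<le> light_part (2 / ln (real m)) p i"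
      using p_nonneg[of i] by (auto simp: light_part_def)
  qed
  finally have "ln (real A) / 2 \<le> (\<Sum>i\<in>{a<..b}. light_part (2 / ln (real m)) p i)" using lnA by linarith
  moreover have "real r * (ln (real A) / 2) \<le> mass (light_part (2 / ln (real m)) p) a"
    using Suc.IH bounds(2) by (simp add: a_def)
  moreover have "mass (light_part (2 / ln (real m)) p) b
      = mass (light_part (2 / ln (real m)) p) a + (\<Sum>i\<in>{a<..b}. light_part (2 / ln (real m)) p i)"
  proof -
    have "{1..b} = {1..a} \<union> {a<..b}" using \<open>a \<le> n\<close> \<open>n \<le> b\<close> by auto
    show ?thesis unfolding mass_def \<open>{1..b} = {1..a} \<union> {a<..b}\<close> by (rule sum.union_disjoint) auto
  qed
  ultimately show ?case unfolding b[symmetric] by (simp add: algebra_simps add_divide_distrib)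
qed

text \<open>With \<open>m = A ^ 2\<close>, about
  \<open>ln m / (4 * (\<kappa> + 1) * ln (ln m))\<close> windows fit between \<open>A\<close> and
  \<open>m\<close>, each of mass at least \<open>ln A / 2 = ln m / 4\<close>; rounding their number
  down costs a further factor 2.\<close>

lemma light_mass_ge:
  assumes exp: "L_exp_smallo D rate"
    and whp: "\<forall>\<^sub>F n in sequentially. \<exists>T. L_whp D n = enat T \<and> real T \<le> real n * (ln (real n)) ^ \<kappa>"
    and j0: "1 \<le> j0" "0 < p j0" "\<forall>i\<in>{1..<j0}. p i = 0" and \<kappa>: "2 \<le> \<kappa>"
  shows "\<forall>\<^sub>F A in sequentially.
    (ln (real (A ^ 2)))^2 / ln (ln (real (A ^ 2))) / (32 * (real \<kappa> + 1))
      \<le> mass (light_part (2 / ln (real (A ^ 2))) p) (A ^ 2)"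
proof -
  define C where "C = real \<kappa> + 1"
  have C: "0 < C" by (simp add: C_def)
  have "\<forall>\<^sub>F N::nat in sequentially. \<forall>n\<ge>N. \<forall>a b. real a * (ln (real n))^2 \<le> real n \<longrightarrow>
    real n * (ln (real n)) ^ \<kappa> \<le> real b \<longrightarrow>
    ln (real n) / 2 \<le> (\<Sum>i\<in>{a<..b}. light_part (1 / ln (real n)) p i)"
    using light_mass_scale_ge[OF exp whp j0] by (rule eventually_all_ge_at_top)
  moreover have "\<forall>\<^sub>F A::nat in sequentially. 2 \<le> ln (real A)" by real_asymp
  moreover have "\<forall>\<^sub>F A::nat in sequentially. 0 < ln (ln (real A ^ 2))" by real_asymp
  moreover have "\<forall>\<^sub>F A::nat in sequentially. 2 \<le> ln (real A ^ 2) / (4 * C * ln (ln (real A ^ 2)))"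
    using C by real_asymp
  ultimately show ?thesis
  proof eventually_elim
    case (elim A)
    define m where "m = A ^ 2"
    define X where "X = ln (real m)"
    have A: "1 < A" using elim(2) by (cases "A \<le> 1") (auto simp: le_Suc_eq)
    have X: "X = 2 * ln (real A)" using A by (simp add: X_def m_def ln_realpow)
    then have X4: "4 \<le> X" using elim(2) by simp
    have lnX: "0 < ln X" "2 \<le> X / (4 * C * ln X)" using elim(3,4) by (simp_all add: X_def m_def)
    define \<rho> where "\<rho> = nat \<lceil>X ^ \<kappa>\<rceil>"
    have X1: "1 \<le> X ^ \<kappa>" using X4 by simp
    then have \<rho>: "X ^ \<kappa> \<le> real \<rho>" "real \<rho> \<le> X ^ \<kappa> + 1" unfolding \<rho>_def by linarith+
    \<comment> \<open>Rounding up in \<open>\<rho>\<close> is absorbed by one more power of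
      \<open>X\<close>, hence \<open>\<kappa> + 1\<close>.\<close>
    have "real \<rho> \<le> 2 * X ^ \<kappa>" using \<rho> X1 by linarith
    also have "\<dots> \<le> X * X ^ \<kappa>" using X4 X1 by (intro mult_right_mono) auto
    finally have "real \<rho> \<le> X ^ (\<kappa> + 1)" by simp
    moreover have \<rho>1: "1 < real \<rho>"
    proof -
      have "X ^ 1 \<le> X ^ \<kappa>" using X4 \<kappa> by (intro power_increasing) auto
      with X4 \<rho> show ?thesis by simp
    qed
    ultimately have "ln (real \<rho>) \<le> ln (X ^ (\<kappa> + 1))" using X4 by (subst ln_le_cancel_iff) auto
    also have "\<dots> = real (\<kappa> + 1) * ln X" by (rule ln_realpow)
    also have "\<dots> = C * ln X" by (simp add: C_def)
    finally have ln\<rho>: "ln (real \<rho>) \<le> C * ln X" .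
    define r where "r = nat \<lfloor>ln (real A) / (2 * ln (real \<rho>))\<rfloor>"
    have ln\<rho>0: "0 < ln (real \<rho>)" using \<rho>1 by simp
    have "0 \<le> ln (real A) / (2 * ln (real \<rho>))" using elim(2) ln\<rho>0 by simp
    then have r: "real r \<le> ln (real A) / (2 * ln (real \<rho>))" "ln (real A) / (2 * ln (real \<rho>)) - 1 \<le> real r"
      unfolding r_def by linarith+
    have "ln (real (\<rho> ^ (2 * r))) = 2 * real r * ln (real \<rho>)" using \<rho>1 by (simp add: ln_realpow)
    also have "\<dots> \<le> ln (real A)" using r(1) ln\<rho>0 by (simp add: field_simps)
    finally have "ln (real (\<rho> ^ (2 * r))) \<le> ln (real A)" .
    then have "real (\<rho> ^ (2 * r)) \<le> real A" using \<rho>1 A by (subst (asm) ln_le_cancel_iff) auto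
    then have "\<rho> ^ (2 * r) \<le> A" by (simp only: of_nat_le_iff)
    then have Am: "A * \<rho> ^ (2 * r) \<le> m" by (simp add: m_def power2_eq_square)
    let ?l = "light_part (2 / ln (real m)) p"
    define Y where "Y = X / (4 * C * ln X)"
    have "Y = ln (real A) / (2 * (C * ln X))" by (simp add: Y_def X)
    also have "\<dots> \<le> ln (real A) / (2 * ln (real \<rho>))"
      using ln\<rho> ln\<rho>0 elim(2) C lnX(1) by (intro divide_left_mono) auto
    finally have "Y / 2 \<le> real r" using r(2) lnX(2) unfolding Y_def[symmetric] by linarith
    then have "Y / 2 * (X / 4) \<le> real r * (X / 4)" using X4 by (intro mult_right_mono) auto
    also have "\<dots> = real r * (ln (real A) / 2)" by (simp add: X)
    also have "\<dots> \<le> mass ?l (A * \<rho> ^ (2 * r))"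
      using elim(1) A \<kappa> X4 \<rho>(1) Am
      by (intro light_mass_geometric[where \<kappa>=\<kappa>]) (auto simp: m_def X_def)
    also have "\<dots> \<le> mass ?l m"
      unfolding mass_def using Am light_part_nonneg by (intro sum_mono2) auto
    also have "Y / 2 * (X / 4) = X^2 / ln X / (32 * (real \<kappa> + 1))"
      by (simp add: Y_def C_def power2_eq_square)
    finally show ?case by (simp add: X_def m_def)
  qed
qed

text \<open>A second pass with \<open>\<beta> = 48 * ln (ln m)\<close> and
  \<open>h = 2 / ln m\<close>: now \<open>exp (- \<beta> / 8) = (ln m) powr (-6)\<close> beats the
  polylogarithmic mass, and \<open>h * ln (m ^ 5)\<close> is constant. This pushes the light mass
  below its lower bound of order \<open>(ln m)^2 / ln (ln m)\<close>.\<close>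

lemma not_both_bounds:
  assumes exp: "L_exp_smallo D rate" and whp: "L_whp_bigo D (\<lambda>n. real n * (ln (real n)) ^ k)"
  shows False
proof -
  define \<kappa> where "\<kappa> = k + 2"
  note whp' = L_whp_polylog[OF whp, folded \<kappa>_def]
  have "\<forall>\<^sub>F n in sequentially. 2 \<le> n \<and> L_whp D n \<noteq> \<infinity>"
    using eventually_ge_at_top[of 2] whp' by eventually_elim auto
  then obtain n where "2 \<le> n" "L_whp D n \<noteq> \<infinity>" using eventually_happens by fastforce
  from ex_first_attempt[OF this] obtain j0
    where j0: "1 \<le> j0" "0 < p j0" "\<forall>i\<in>{1..<j0}. p i = 0" by (metis atLeastLessThan_iff)
  define c where "c = 1 / (32 * (real \<kappa> + 1))"
  \<comment> \<open>As \<open>24576 = 2 * 256 * 48\<close>, the second term of the bound in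
    \<open>light_mass_le\<close> becomes half of the lower bound.\<close>
  define \<epsilon> where "\<epsilon> = c / 24576"
  define b where "b = 12 / p j0"
  have pos: "0 < c" "0 < \<epsilon>" "0 < b" using j0 by (simp_all add: c_def \<epsilon>_def b_def)
  \<comment> \<open>The lower bound is stated along squares, so the upper bound is transported to
    them.\<close>
  have filt: "filterlim (\<lambda>A::nat. A ^ 2) sequentially sequentially" by real_asymp
  have "\<forall>\<^sub>F m in sequentially. mass p (m ^ 5) \<le> (ln (real (m ^ 5))) ^ 4"
    using mass_le_polylog[OF exp j0] by (rule eventually_compose_filterlim) real_asymp
  moreover have "\<forall>\<^sub>F m::nat in sequentially. 0 < 2 / ln (real m) \<and> 1 \<le> 48 * ln (ln (real m))"
    by (intro eventually_conj) real_asymp+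
  moreover have "\<forall>\<^sub>F m::nat in sequentially. 1 + real m * (b * ln (ln (real m)) + 1) \<le> real m ^ 4 / 2"
    using pos by real_asymp
  moreover have "\<forall>\<^sub>F m::nat in sequentially. exp (1 - 48 * ln (ln (real m)) / 8) * (5 * ln (real m)) ^ 4 \<le> 1 / 160"
    by real_asymp
  moreover have "\<forall>\<^sub>F m::nat in sequentially. 2 / ln (real m) * ln (2 * (real m ^ 5 + 1)) \<le> 48 * ln (ln (real m)) / 64"
    by real_asymp
  moreover have "\<forall>\<^sub>F m::nat in sequentially. 96 * ln (ln (real m)) < c / 2 * ((ln (real m))^2 / ln (ln (real m)))"
    using pos by real_asymp
  ultimately have "\<forall>\<^sub>F m in sequentially. mass (light_part (2 / ln (real m)) p) m < c * ((ln (real m))^2 / ln (ln (real m)))"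
    using light_mass_le[OF exp j0 pos(2)]
  proof eventually_elim
    case (elim m)
    define Z where "Z = ln (ln (real m))"
    have Z: "0 < Z" using conjunct2[OF elim(2)] unfolding Z_def by linarith
    have "0 < m" using elim(2) by (cases m) auto
    then have "mass p (m ^ 5) \<le> (5 * ln (real m)) ^ 4" using elim(1) by (simp add: ln_realpow)
    then have massT: "exp (1 - 48 * ln (ln (real m)) / 8) * mass p (m ^ 5) \<le> 1 / 160"
      by (intro order_trans[OF mult_left_mono elim(4)]) auto
    have "b * ln (ln (real m)) = 48 * ln (ln (real m)) / (4 * p j0)" by (simp add: b_def)
    with elim(3) have parties: "1 + real m * (48 * ln (ln (real m)) / (4 * p j0) + 1) \<le> real m ^ 4 / 2" by simp
    have "mass (light_part (2 / ln (real m)) p) m \<le> 2 * (48 * Z) + 256 * \<epsilon> * (48 * Z) * (ln m)^2 / Z^2"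
      unfolding Z_def
      using elim(7)[rule_format, OF _ _ parties massT elim(5)] elim(2) by blast
    also have "\<dots> = 96 * Z + c / 2 * ((ln m)^2 / Z)"
      using Z by (simp add: \<epsilon>_def power2_eq_square field_simps)
    finally show ?case using elim(6) unfolding Z_def[symmetric] by linarith
  qed
  note light_lt = eventually_compose_filterlim[OF this filt]
  have "2 \<le> \<kappa>" by (simp add: \<kappa>_def)
  from light_lt light_mass_ge[OF exp whp' j0 this] have "\<forall>\<^sub>F A::nat in sequentially. False"
  proof eventually_elim
    case (elim A)
    then show ?case by (simp add: c_def mult.commute)
  qed
  then show False by simp
qed

end

theorem theorem1p5:
  "\<not> (\<exists>D :: (nat \<Rightarrow> bool) measure.
        ack_protocol D \<and> memoryless D \<and>
        L_exp_smallo D (\<lambda>n. real n * (ln (real n))^2 / (ln (ln (real n)))^2) \<and>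
        (\<exists>k::nat. L_whp_bigo D (\<lambda>n. real n * (ln (real n)) ^ k)))"
  using memoryless_protocol.not_both_bounds memoryless_protocol.intro by blast

end
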